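(* Let $L$ be the infinitesimal generator of an exponentially stable $C_0$-semigroup $\{e^{tL}\}_{t\geq0}$ on a Banach space $X$. Then, for any $u\in X$, $$-\log(-L)u=\lim_{s\to0^+}\frac{1}{\Gamma(1+s)}\int_0^\infty\frac{e^{tL}u-e^{-t}u}{t^{1-s}}\,dt,$$ in the sense that $u\in D(\log(-L))$ if and only if the limit on the right-hand side exists in $X$, and in that case the equality holds. In particular, if $u\in D(L)$ then $u\in D(\log(-L))$ and $$-\log(-L)u=\int_0^\infty\frac{e^{tL}u-e^{-t}u}{t}\,dt.$$
   Context: $X$ is a Banach space with identity operator $I$, $\Gamma$ is the Gamma function, and integrals of $X$-valued functions are Bochner integrals. A $C_0$-semigroup $\{e^{tL}\}_{t\ge0}$ on $X$ is a family of bounded linear operators with $e^{0L}=I$, $e^{t_1L}e^{t_2L}=e^{(t_1+t_2)L}$ and $\lim_{t\to0^+}e^{tL}u=u$ for all $u\in X$; its infinitesimal generator is $Lu=\lim_{t\to0^+}(e^{tL}u-u)/t$, with $D(L)$ the set of $u$ for which the limit exists in $X$. It is exponentially stable if there are $M,\varepsilon>0$ with $\|e^{tL}u\|_X\le Me^{-\varepsilon t}\|u\|_X$ for all $u\in X$, $t\ge0$. In this case $A=-L$ is a nonnegative operator (for every $\mu>0$, $\mu I+A:D(A)\to X$ is bijective with bounded inverse, and $\sup_{\mu>0}\|\mu(\mu I+A)^{-1}\|<\infty$), $A:D(A)\to X$ is bijective with bounded inverse, and $B=A^{-1}$ is a bounded nonnegative operator. Negative fractional powers (only small $s$ is needed):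 for $0<s<1$, $A^{-s}:=(A^{-1})^s=B^s$, where for the bounded nonnegative operator $B$, $B^su=\frac{\sin(s\pi)}{\pi}\int_0^\infty\mu^{s-1}(\mu I+B)^{-1}Bu\,d\mu$ for all $u\in X$. Logarithm: $-\log(A)$ is the infinitesimal generator of the semigroup $\{A^{-s}\}_{s\ge0}$ (with $A^0=I$), i.e. $-\log(A)u=\lim_{s\to0^+}\frac1s(A^{-s}u-u)$, with $D(\log(A))$ the set of $u\in X$ for which this limit exists in $X$. *)

theory Defs
  imports "HOL-Analysis.Analysis"
begin

section \<open>Bochner integral in an arbitrary Banach space\<close>

text \<open>
  The constants \<open>has_bochner_integral\<close> and \<open>lebesgue_integral\<close> of HOL-Analysis require a second
  countable (separable) target space. The definitions below repeat them without that restriction.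
  Approximation by simple functions in \<open>L\<^sup>1\<close> forces \<open>f\<close> to be almost everywhere separably valued, so
  together with Borel measurability this is the usual strong measurability.
\<close>

definition has_Bochner_integral ::
    "'a measure \<Rightarrow> ('a \<Rightarrow> 'b::real_normed_vector) \<Rightarrow> 'b \<Rightarrow> bool" where
  "has_Bochner_integral M f x \<longleftrightarrow>
     f \<in> borel_measurable M \<and>
     (\<exists>s. (\<forall>i::nat. Bochner_Integration.simple_bochner_integrable M (s i)) \<and>
          (\<lambda>i. \<integral>\<^sup>+y. ennreal (norm (f y - s i y)) \<partial>M) \<longlonglongrightarrow> 0 \<and>
          (\<lambda>i. Bochner_Integration.simple_bochner_integral M (s i)) \<longlonglongrightarrow> x)"

definition has_Bochner_integral_on ::
    "(real \<Rightarrow> 'b::real_normed_vector) \<Rightarrow> 'b \<Rightarrow> real set \<Rightarrow> bool" where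
  "has_Bochner_integral_on f x S \<longleftrightarrow>
     has_Bochner_integral lborel (\<lambda>t. indicator S t *\<^sub>R f t) x"

definition Bochner_integrable_on :: "(real \<Rightarrow> 'b::real_normed_vector) \<Rightarrow> real set \<Rightarrow> bool" where
  "Bochner_integrable_on f S \<longleftrightarrow> (\<exists>x. has_Bochner_integral_on f x S)"

definition Bochner_integral_on :: "real set \<Rightarrow> (real \<Rightarrow> 'b::real_normed_vector) \<Rightarrow> 'b" where
  "Bochner_integral_on S f =
     (if Bochner_integrable_on f S then THE x. has_Bochner_integral_on f x S else 0)"

section \<open>Semigroups and their generators\<close>

text \<open>Only the values \<open>T t\<close> with \<open>t \<ge> 0\<close> of a semigroup \<open>T\<close> are relevant.\<close>

definition C0_semigroup :: "(real \<Rightarrow> 'a::real_normed_vector \<Rightarrow> 'a) \<Rightarrow> bool" where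
  "C0_semigroup T \<longleftrightarrow>
     (\<forall>t\<ge>0. bounded_linear (T t)) \<and>
     T 0 = id \<and>
     (\<forall>t1\<ge>0. \<forall>t2\<ge>0. T t1 \<circ> T t2 = T (t1 + t2)) \<and>
     (\<forall>u. ((\<lambda>t. T t u) \<longlongrightarrow> u) (at_right 0))"

definition exponentially_stable :: "(real \<Rightarrow> 'a::real_normed_vector \<Rightarrow> 'a) \<Rightarrow> bool" where
  "exponentially_stable T \<longleftrightarrow>
     (\<exists>M>0. \<exists>\<epsilon>>0. \<forall>u. \<forall>t\<ge>0. norm (T t u) \<le> M * exp (- \<epsilon> * t) * norm u)"

definition generator_domain :: "(real \<Rightarrow> 'a::real_normed_vector \<Rightarrow> 'a) \<Rightarrow> 'a set" where
  "generator_domain T = {u. \<exists>v. ((\<lambda>t. (T t u - u) /\<^sub>R t) \<longlongrightarrow> v) (at_right 0)}"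

text \<open>Meaningful on \<open>generator_domain T\<close> only.\<close>

definition generator :: "(real \<Rightarrow> 'a::real_normed_vector \<Rightarrow> 'a) \<Rightarrow> 'a \<Rightarrow> 'a" where
  "generator T u = Lim (at_right 0) (\<lambda>t. (T t u - u) /\<^sub>R t)"

section \<open>Fractional powers and logarithm\<close>

text \<open>
  The power \<open>B\<^sup>s\<close> of a bounded nonnegative operator \<open>B\<close>, for \<open>0 \<le> s < 1\<close>; here
  \<open>inv (\<lambda>x. \<mu> *\<^sub>R x + B x)\<close> is the resolvent \<open>(\<mu> I + B)\<close> to the power \<open>-1\<close>. Values for other \<open>s\<close>
  have no meaning and are not used: a generator only depends on small positive \<open>s\<close>.
\<close>

definition frac_power :: "('a::real_normed_vector \<Rightarrow> 'a) \<Rightarrow> real \<Rightarrow> 'a \<Rightarrow> 'a" where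
  "frac_power B s u =
     (if s = 0 then u
      else (sin (s * pi) / pi) *\<^sub>R
        Bochner_integral_on {0<..}
          (\<lambda>\<mu>. (\<mu> powr (s - 1)) *\<^sub>R inv (\<lambda>x. \<mu> *\<^sub>R x + B x) (B u)))"

text \<open>
  In what follows an unbounded operator is given by its domain \<open>D\<close> and a function \<open>A\<close> whose values
  off \<open>D\<close> are ignored. \<open>neg_frac_power D A s\<close> is the power of \<open>A\<close> with exponent \<open>-s\<close>.
\<close>

definition neg_frac_power ::
    "'a set \<Rightarrow> ('a::real_normed_vector \<Rightarrow> 'a) \<Rightarrow> real \<Rightarrow> 'a \<Rightarrow> 'a" where
  "neg_frac_power D A s = frac_power (the_inv_into D A) s"

definition op_log_domain :: "'a set \<Rightarrow> ('a::real_normed_vector \<Rightarrow> 'a) \<Rightarrow> 'a set" where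
  "op_log_domain D A = generator_domain (neg_frac_power D A)"

definition op_log :: "'a set \<Rightarrow> ('a::real_normed_vector \<Rightarrow> 'a) \<Rightarrow> 'a \<Rightarrow> 'a" where
  "op_log D A u = - generator (neg_frac_power D A) u"

end

theory Submission
  imports Defs
begin

text \<open>
  Put \<open>A = -L\<close> and \<open>B = A\<close> to the power \<open>-1\<close>. The resolvent of \<open>L\<close> is the Laplace transform of the
  semigroup, and \<open>(\<mu> I + B)\<^sup>-\<^sup>1 B = \<mu>\<^sup>-\<^sup>1 (\<mu>\<^sup>-\<^sup>1 I + A)\<^sup>-\<^sup>1\<close>. Inserting this into the definition of \<open>B\<^sup>s\<close>
  and exchanging the integrals turns the kernel into
  \<open>\<integral> \<mu> powr (s - 2) * exp (- t / \<mu>) d\<mu> = \<Gamma>(1 - s) * t powr (s - 1)\<close>, so by the reflection formula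
  \<open>\<Gamma>(s) B\<^sup>s u = \<integral> t powr (s - 1) * T(t) u dt\<close>. Writing \<open>\<Gamma>(s) u\<close> as the same integral with \<open>exp (- t) u\<close> in
  place of \<open>T(t) u\<close> and using \<open>\<Gamma>(1 + s) = s \<Gamma>(s)\<close>, the difference quotient \<open>(B\<^sup>s u - u) / s\<close> equals the
  expression under the limit for every \<open>0 < s < 1\<close>, not merely in the limit. For \<open>u\<close> in the domain of \<open>L\<close>
  dominated convergence applies as \<open>s \<rightarrow> 0\<close>.

  The space need not be separable, so vector-valued integrals are computed as Henstock--Kurzweil
  integrals, which extend the Bochner integral. Vector-valued limits are reduced to real dominated
  convergence for the norm of the difference, and Fubini's theorem is only needed for continuous
  functions on compact rectangles.
\<close>

section \<open>Bochner and Henstock--Kurzweil integrals\<close>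

text \<open>In a nonseparable space the difference of two Borel functions may fail to be measurable.
  Here \<open>s\<close> has finite range, so it suffices to freeze its value at each
  \<open>c\<close> and use continuity of \<open>norm (y - c)\<close>.\<close>

lemma borel_measurable_norm_diff_simple:
  fixes f s :: "'a \<Rightarrow> 'b::real_normed_vector"
  assumes f: "f \<in> borel_measurable M" and s: "simple_function M s"
  shows "(\<lambda>x. norm (f x - s x)) \<in> borel_measurable M"
proof (rule measurable_compose_countable'[where f = "\<lambda>c x. norm (f x - c)" and g = s and I = "s ` space M"])
  show "(\<lambda>x. norm (f x - c)) \<in> borel_measurable M" for c
  proof (rule measurable_compose[OF f])
    show "(\<lambda>y. norm (y - c)) \<in> borel_measurable borel"
      by (intro borel_measurable_continuous_onI continuous_intros)
  qed
  have "finite (s ` space M)" using s by (auto simp: simple_function_def)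
  then show "countable (s ` space M)" by (rule countable_finite)
  show "s \<in> measurable M (count_space (s ` space M))"
    unfolding measurable_count_space_eq2[OF \<open>finite (s ` space M)\<close>]
    using s by (auto simp: simple_function_def)
qed

text \<open>Write \<open>s\<close> as the finite sum of its values times indicators of its level
  sets. A level set of a nonzero value lies in the support of \<open>s\<close> and so has finite
  measure; the value 0 contributes nothing.\<close>

lemma has_integral_simple_bochner:
  fixes s :: "'n::euclidean_space \<Rightarrow> 'b::real_normed_vector"
  assumes "Bochner_Integration.simple_bochner_integrable lborel s"
  shows "(s has_integral Bochner_Integration.simple_bochner_integral lborel s) UNIV"
proof -
  have s: "simple_function lborel s" and fin: "emeasure lborel {y. s y \<noteq> 0} \<noteq> \<infinity>"
    using assms by (auto elim: Bochner_Integration.simple_bochner_integrable.cases)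
  have fin_range: "finite (range s)" and meas: "{x. s x = y} \<in> sets borel" for y
    using simple_functionD(1)[OF s] simple_functionD(2)[OF s, of "{y}"] by (auto simp: vimage_def)
  have support: "{x. s x \<noteq> 0} \<in> sets borel"
  proof -
    have "{x. s x \<noteq> 0} = UNIV - {x. s x = 0}" by auto
    then show ?thesis using meas[of 0] by auto
  qed
  have "((\<lambda>x. indicat_real {x. s x = y} x *\<^sub>R y) has_integral measure lborel {x. s x = y} *\<^sub>R y) UNIV" for y
  proof (cases "y = 0")
    case False
    have "emeasure lborel {x. s x = y} \<le> emeasure lborel {x. s x \<noteq> 0}"
      using support False by (intro emeasure_mono) auto
    then have "emeasure lborel {x. s x = y} < \<infinity>"
      using fin by (auto simp: less_top top_unique)
    then have "((\<lambda>x. 1) has_integral measure lborel {x. s x = y}) {x. s x = y}"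
      by (intro has_integral_measure_lborel meas)
    then have "((\<lambda>x. indicat_real {x. s x = y} x) has_integral measure lborel {x. s x = y}) UNIV"
      by (subst (asm) has_integral_restrict_UNIV[symmetric]) (simp add: indicator_def of_bool_def)
    then show ?thesis by (rule has_integral_scaleR_left)
  qed simp
  then have "((\<lambda>x. \<Sum>y\<in>range s. indicat_real {x. s x = y} x *\<^sub>R y)
      has_integral (\<Sum>y\<in>range s. measure lborel {x. s x = y} *\<^sub>R y)) UNIV"
    by (intro has_integral_sum fin_range)
  moreover have "(\<Sum>y\<in>range s. indicat_real {x. s x = y} x *\<^sub>R y) = s x" for x
  proof -
    have "(\<Sum>y\<in>range s. indicat_real {x. s x = y} x *\<^sub>R y) = (\<Sum>y\<in>range s. if y = s x then y else 0)"
      by (intro sum.cong) auto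
    then show ?thesis using fin_range by simp
  qed
  ultimately show ?thesis
    by (simp add: Bochner_Integration.simple_bochner_integral_def)
qed

text \<open>Cauchy criterion for tagged divisions: on a fine division the Riemann sums of
  \<open>f\<close> and \<open>s\<close> differ by at most the Riemann sum of \<open>h\<close>, which
  is close to the small integral of \<open>h\<close>.\<close>

lemma integrable_on_cbox_approx:
  fixes f :: "'n::euclidean_space \<Rightarrow> 'b::banach"
  assumes approx: "\<And>e. e > 0 \<Longrightarrow> \<exists>s h. s integrable_on cbox a b \<and> h integrable_on cbox a b \<and>
      integral (cbox a b) h < e \<and> (\<forall>x\<in>cbox a b. norm (f x - s x) \<le> h x)"
  shows "f integrable_on cbox a b"
  unfolding integrable_Cauchy
proof (intro allI impI)
  fix e :: real
  assume "e > 0"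
  \<comment> \<open>Each division costs three errors of size \<open>e/6\<close> (integral of
    \<open>h\<close>, its Riemann sum, Riemann sum of \<open>s\<close>), and two divisions are
    compared.\<close>
  then have e: "e/6 > 0" by simp
  obtain s h where s: "s integrable_on cbox a b" and h: "h integrable_on cbox a b"
    and he: "integral (cbox a b) h < e/6" and le: "\<And>x. x \<in> cbox a b \<Longrightarrow> norm (f x - s x) \<le> h x"
    using approx[OF e] by blast
  obtain \<gamma>1 where \<gamma>1: "gauge \<gamma>1" "\<And>p. p tagged_division_of cbox a b \<Longrightarrow> \<gamma>1 fine p \<Longrightarrow>
      norm ((\<Sum>(x,k)\<in>p. measure lborel k *\<^sub>R s x) - integral (cbox a b) s) < e/6"
    using integrable_integral[OF s] e unfolding has_integral by meson
  obtain \<gamma>2 where \<gamma>2: "gauge \<gamma>2" "\<And>p. p tagged_division_of cbox a b \<Longrightarrow> \<gamma>2 fine p \<Longrightarrow>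
      norm ((\<Sum>(x,k)\<in>p. measure lborel k *\<^sub>R h x) - integral (cbox a b) h) < e/6"
    using integrable_integral[OF h] e unfolding has_integral by meson
  have close: "norm ((\<Sum>(x,k)\<in>p. measure lborel k *\<^sub>R f x) - integral (cbox a b) s) < e/2"
    if p: "p tagged_division_of cbox a b" and fine: "(\<lambda>x. \<gamma>1 x \<inter> \<gamma>2 x) fine p" for p
  proof -
    have f1: "\<gamma>1 fine p" and f2: "\<gamma>2 fine p" using fine by (simp_all add: fine_Int)
    have "(\<Sum>(x,k)\<in>p. measure lborel k *\<^sub>R f x) - (\<Sum>(x,k)\<in>p. measure lborel k *\<^sub>R s x)
        = (\<Sum>(x,k)\<in>p. measure lborel k *\<^sub>R (f x - s x))"
      by (simp add: sum_subtractf[symmetric] split_def scaleR_diff_right)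
    also have "norm \<dots> \<le> (\<Sum>(x,k)\<in>p. measure lborel k *\<^sub>R h x)"
    proof (rule sum_norm_le, clarsimp)
      fix x k assume "(x, k) \<in> p"
      then have "x \<in> cbox a b" using p by (auto dest: tag_in_interval)
      show "measure lborel k * norm (f x - s x) \<le> measure lborel k * h x"
        using le[OF \<open>x \<in> cbox a b\<close>] by (simp add: mult_left_mono)
    qed
    also have "\<dots> < e/6 + e/6"
      using \<gamma>2(2)[OF p f2] he unfolding real_norm_def real_scaleR_def by linarith
    finally have *: "norm ((\<Sum>(x,k)\<in>p. measure lborel k *\<^sub>R f x) - (\<Sum>(x,k)\<in>p. measure lborel k *\<^sub>R s x)) < e/6 + e/6" .
    show ?thesis
      using norm_diff_triangle_less[OF * \<gamma>1(2)[OF p f1]] by simp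
  qed
  show "\<exists>\<gamma>. gauge \<gamma> \<and> (\<forall>D1 D2. D1 tagged_division_of cbox a b \<and> \<gamma> fine D1 \<and>
      D2 tagged_division_of cbox a b \<and> \<gamma> fine D2 \<longrightarrow>
      norm ((\<Sum>(x,K)\<in>D1. measure lborel K *\<^sub>R f x) - (\<Sum>(x,K)\<in>D2. measure lborel K *\<^sub>R f x)) < e)"
  proof (intro exI conjI allI impI)
    show "gauge (\<lambda>x. \<gamma>1 x \<inter> \<gamma>2 x)" using \<gamma>1(1) \<gamma>2(1) by (rule gauge_Int)
    fix D1 D2
    assume "D1 tagged_division_of cbox a b \<and> (\<lambda>x. \<gamma>1 x \<inter> \<gamma>2 x) fine D1 \<and>
      D2 tagged_division_of cbox a b \<and> (\<lambda>x. \<gamma>1 x \<inter> \<gamma>2 x) fine D2"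
    then show "norm ((\<Sum>(x,K)\<in>D1. measure lborel K *\<^sub>R f x) - (\<Sum>(x,K)\<in>D2. measure lborel K *\<^sub>R f x)) < e"
      using norm_diff_triangle_less[OF close close[unfolded norm_minus_commute[of _ "integral (cbox a b) s"]], of D1 D2] by simp
  qed
qed

text \<open>The errors in the definition of the Bochner integral are nonnegative Lebesgue integrals;
  this turns them into Henstock--Kurzweil integrals, which can be restricted to boxes.\<close>

lemma integral_less_if_nn_integral_less:
  fixes h :: "'n::euclidean_space \<Rightarrow> real"
  assumes m: "h \<in> borel_measurable borel" and nonneg: "\<And>x. 0 \<le> h x"
    and less: "(\<integral>\<^sup>+x. ennreal (h x) \<partial>lborel) < ennreal e"
  shows "h integrable_on UNIV" "integral UNIV h < e"
proof -
  show int: "h integrable_on UNIV"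
    using less by (intro nn_integral_integrable_on m nonneg) (auto intro: order.strict_trans simp: less_top)
  have "(\<integral>\<^sup>+x. ennreal (h x) \<partial>lborel) = ennreal (integral UNIV h)"
    by (intro nn_integral_has_integral_lborel m integrable_integral int nonneg)
  then show "integral UNIV h < e"
    using less by (simp add: ennreal_less_iff integral_nonneg int nonneg)
qed

text \<open>On a box, \<open>integrable_on_cbox_approx\<close> applies with
  \<open>norm (f y - s i y)\<close> as error function. The passage to the whole space works because
  the error on every box is at most the error on \<open>UNIV\<close>, uniformly in the box.\<close>

lemma has_integral_if_has_Bochner_integral:
  fixes f :: "'n::euclidean_space \<Rightarrow> 'b::banach"
  assumes f: "has_Bochner_integral lborel f x"
  shows "(f has_integral x) UNIV"
proof -
  let ?I = "Bochner_Integration.simple_bochner_integral lborel"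
  from f obtain s where meas: "f \<in> borel_measurable lborel"
    and s: "\<And>i::nat. Bochner_Integration.simple_bochner_integrable lborel (s i)"
    and conv: "(\<lambda>i. \<integral>\<^sup>+y. ennreal (norm (f y - s i y)) \<partial>lborel) \<longlonglongrightarrow> 0"
    and limit: "(\<lambda>i. ?I (s i)) \<longlonglongrightarrow> x"
    unfolding has_Bochner_integral_def by blast
  have simple: "simple_function lborel (s i)" for i
    using s[of i] by (auto elim: Bochner_Integration.simple_bochner_integrable.cases)
  let ?h = "\<lambda>i y. norm (f y - s i y)"
  have approx: "\<exists>i. (?h i integrable_on UNIV) \<and> integral UNIV (?h i) < e \<and> norm (?I (s i) - x) < e"
    if "e > 0" for e
  proof -
    have "eventually (\<lambda>i. (\<integral>\<^sup>+y. ennreal (?h i y) \<partial>lborel) < ennreal e) sequentially"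
      using conv that by (intro order_tendstoD(2)) auto
    moreover have "eventually (\<lambda>i. norm (?I (s i) - x) < e) sequentially"
      using tendstoD[OF limit that] by (simp add: dist_norm)
    ultimately have "eventually (\<lambda>i. (\<integral>\<^sup>+y. ennreal (?h i y) \<partial>lborel) < ennreal e \<and> norm (?I (s i) - x) < e) sequentially"
      by (rule eventually_conj)
    then obtain i where i: "(\<integral>\<^sup>+y. ennreal (?h i y) \<partial>lborel) < ennreal e" "norm (?I (s i) - x) < e"
      by (auto simp: eventually_sequentially)
    have m: "?h i \<in> borel_measurable borel"
      using borel_measurable_norm_diff_simple[OF meas simple] by simp
    show ?thesis
      using integral_less_if_nn_integral_less[OF m _ i(1)] i(2) by auto
  qed
  have s_int: "(s i has_integral ?I (s i)) UNIV" for i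
    by (rule has_integral_simple_bochner[OF s])
  have h_box: "integral (cbox a b) (?h i) \<le> integral UNIV (?h i)" "?h i integrable_on cbox a b"
    if "?h i integrable_on UNIV" for i a b
    using that by (auto intro!: integral_subset_le intro: integrable_on_subcbox)
  have f_box: "f integrable_on cbox a b" for a b
  proof (rule integrable_on_cbox_approx)
    fix e :: real assume "e > 0"
    then obtain i where i: "?h i integrable_on UNIV" "integral UNIV (?h i) < e" using approx by blast
    have "s i integrable_on cbox a b"
      using s_int[of i] by (intro integrable_on_subcbox[of _ UNIV]) auto
    then show "\<exists>s h. s integrable_on cbox a b \<and> h integrable_on cbox a b \<and>
      integral (cbox a b) h < e \<and> (\<forall>x\<in>cbox a b. norm (f x - s x) \<le> h x)"
      using h_box[OF i(1)] i(2) by (intro exI[of _ "s i"] exI[of _ "?h i"]) (auto intro: order.strict_trans1)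
  qed
  show ?thesis
    unfolding has_integral_alt' 
  proof (intro conjI allI impI, simp add: f_box)
    fix e :: real assume "e > 0"
    then have "e/3 > 0" by simp
    then obtain i where i: "?h i integrable_on UNIV" "integral UNIV (?h i) < e/3" "norm (?I (s i) - x) < e/3"
      using approx by blast
    \<comment> \<open>The radius is chosen for \<open>s i\<close> alone. It also serves
      \<open>f\<close>, whose integral differs from that of \<open>s i\<close> by less than
      \<open>e/3\<close> on any box.\<close>
    obtain B where B: "B > 0" "\<And>a b. ball 0 B \<subseteq> cbox a b \<Longrightarrow> norm (integral (cbox a b) (s i) - ?I (s i)) < e/3"
      using s_int[of i, unfolded has_integral_alt', THEN conjunct2, rule_format, OF \<open>e/3 > 0\<close>] by auto
    show "\<exists>B>0. \<forall>a b. ball 0 B \<subseteq> cbox a b \<longrightarrow>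
        norm (integral (cbox a b) (\<lambda>x. if x \<in> UNIV then f x else 0) - x) < e"
    proof (intro exI conjI allI impI, rule B(1))
      fix a b :: 'n assume sub: "ball 0 B \<subseteq> cbox a b"
      have si: "s i integrable_on cbox a b"
        using s_int[of i] by (intro integrable_on_subcbox[of _ UNIV]) auto
      have "norm (integral (cbox a b) f - integral (cbox a b) (s i)) = norm (integral (cbox a b) (\<lambda>y. f y - s i y))"
        using f_box si by (simp add: integral_diff)
      also have "\<dots> \<le> integral (cbox a b) (?h i)"
        using f_box si h_box[OF i(1)] by (intro integral_norm_bound_integral integrable_diff) auto
      also have "\<dots> < e/3" using h_box(1)[OF i(1)] i(2) by (rule order.strict_trans1)
      finally have "norm (integral (cbox a b) f - integral (cbox a b) (s i)) < e/3" .
      from norm_diff_triangle_less[OF norm_diff_triangle_less[OF this B(2)[OF sub]] i(3)]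
      show "norm (integral (cbox a b) (\<lambda>x. if x \<in> UNIV then f x else 0) - x) < e" by simp
    qed
  qed
qed

section \<open>Existence and value of Bochner integrals\<close>

text \<open>Take simple functions with \<open>L\<^sup>1\<close> error below 1/(n+1). Their integrals
  differ by at most the sum of the two errors, hence form a Cauchy sequence, and completeness of the
  space supplies the value of the integral.\<close>

lemma has_Bochner_integral_if_simple_approx:
  fixes f :: "'n::euclidean_space \<Rightarrow> 'b::banach"
  assumes meas: "f \<in> borel_measurable lborel"
    and approx: "\<And>e. e > 0 \<Longrightarrow> \<exists>s. Bochner_Integration.simple_bochner_integrable lborel s \<and>
      (\<integral>\<^sup>+y. ennreal (norm (f y - s y)) \<partial>lborel) < ennreal e"
  shows "\<exists>x. has_Bochner_integral lborel f x"
proof -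
  let ?I = "Bochner_Integration.simple_bochner_integral lborel"
  let ?e = "\<lambda>n. inverse (real (Suc n))"
  have "\<exists>s. Bochner_Integration.simple_bochner_integrable lborel s \<and>
      (\<integral>\<^sup>+y. ennreal (norm (f y - s y)) \<partial>lborel) < ennreal (?e n)" for n
    by (rule approx) simp
  then obtain s where "\<forall>n. Bochner_Integration.simple_bochner_integrable lborel (s n) \<and>
      (\<integral>\<^sup>+y. ennreal (norm (f y - s n y)) \<partial>lborel) < ennreal (?e n)"
    using choice[of "\<lambda>n s. Bochner_Integration.simple_bochner_integrable lborel s \<and>
      (\<integral>\<^sup>+y. ennreal (norm (f y - s y)) \<partial>lborel) < ennreal (?e n)"] by blast
  then have s: "\<And>n. Bochner_Integration.simple_bochner_integrable lborel (s n)"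
    and le: "\<And>n. (\<integral>\<^sup>+y. ennreal (norm (f y - s n y)) \<partial>lborel) < ennreal (?e n)"
    by blast+
  have m: "(\<lambda>y. norm (f y - s n y)) \<in> borel_measurable borel" for n
    using borel_measurable_norm_diff_simple[OF meas, of "s n"] s[of n]
    by (auto elim: Bochner_Integration.simple_bochner_integrable.cases)
  note h = integral_less_if_nn_integral_less[OF m norm_ge_zero le]
  note s_int = has_integral_simple_bochner[OF s]
  have diff: "norm (?I (s m) - ?I (s n)) < ?e m + ?e n" for m n
  proof -
    have "norm (?I (s m) - ?I (s n)) = norm (integral UNIV (\<lambda>y. s m y - s n y))"
      by (simp add: integral_unique[OF has_integral_diff[OF s_int[of m] s_int[of n]]])
    also have "\<dots> \<le> integral UNIV (\<lambda>y. norm (f y - s m y) + norm (f y - s n y))"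
    proof (intro integral_norm_bound_integral integrable_add h)
      show "(\<lambda>y. s m y - s n y) integrable_on UNIV"
        using has_integral_diff[OF s_int s_int] by (rule has_integral_integrable)
      show "norm (s m y - s n y) \<le> norm (f y - s m y) + norm (f y - s n y)" for y
        using norm_triangle_ineq4[of "f y - s n y" "f y - s m y"] by (simp add: algebra_simps)
    qed
    also have "\<dots> = integral UNIV (\<lambda>y. norm (f y - s m y)) + integral UNIV (\<lambda>y. norm (f y - s n y))"
      by (intro integral_add h)
    also have "\<dots> < ?e m + ?e n" by (intro add_strict_mono h)
    finally show ?thesis .
  qed
  have "Cauchy (\<lambda>n. ?I (s n))"
  proof (rule CauchyI)
    fix e :: real assume "e > 0"
    then obtain N where N: "?e N < e/2" using reals_Archimedean[of "e/2"] by auto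
    have *: "?e n \<le> ?e N" if "n \<ge> N" for n using that by (intro le_imp_inverse_le) auto
    have "norm (?I (s m) - ?I (s n)) < e" if "m \<ge> N" "n \<ge> N" for m n
      using diff[of m n] *[OF that(1)] *[OF that(2)] N by linarith
    then show "\<exists>M. \<forall>m\<ge>M. \<forall>n\<ge>M. norm (?I (s m) - ?I (s n)) < e" by blast
  qed
  then obtain x where x: "(\<lambda>n. ?I (s n)) \<longlonglongrightarrow> x"
    using Cauchy_convergent convergent_def by blast
  have "(\<lambda>n. ennreal (?e n)) \<longlonglongrightarrow> ennreal 0"
    by (intro tendsto_ennrealI LIMSEQ_inverse_real_of_nat)
  then have "(\<lambda>n. ennreal (?e n)) \<longlonglongrightarrow> 0" by simp
  then have "(\<lambda>n. \<integral>\<^sup>+y. ennreal (norm (f y - s n y)) \<partial>lborel) \<longlonglongrightarrow> 0"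
  proof (rule tendsto_sandwich[of "\<lambda>_. 0" _ _ "\<lambda>n. ennreal (?e n)", rotated 3])
    show "eventually (\<lambda>n. (\<integral>\<^sup>+y. ennreal (norm (f y - s n y)) \<partial>lborel) \<le> ennreal (?e n)) sequentially"
      by (intro always_eventually allI less_imp_le[OF le])
  qed auto
  with meas s x show ?thesis
    unfolding has_Bochner_integral_def by blast
qed

text \<open>A Henstock--Kurzweil integral is unique, so at most one value satisfies
  \<open>has_Bochner_integral_on\<close> and the \<open>THE\<close> in the definition denotes it.
  Later computations can therefore work with \<open>integral\<close>.\<close>

lemma Bochner_integral_on_eq_integral:
  fixes f :: "real \<Rightarrow> 'b::banach"
  assumes "Bochner_integrable_on f S"
  shows "f integrable_on S" "Bochner_integral_on S f = integral S f"
    "has_Bochner_integral_on f (integral S f) S"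
proof -
  have HK: "(f has_integral x) S" if "has_Bochner_integral_on f x S" for x
  proof -
    have "((\<lambda>t. indicator S t *\<^sub>R f t) has_integral x) UNIV"
      using that unfolding has_Bochner_integral_on_def by (rule has_integral_if_has_Bochner_integral)
    also have "(\<lambda>t. indicator S t *\<^sub>R f t) = (\<lambda>t. if t \<in> S then f t else 0)"
      by (auto simp: indicator_def)
    finally show ?thesis by (simp add: has_integral_restrict_UNIV)
  qed
  obtain x where x: "has_Bochner_integral_on f x S"
    using assms unfolding Bochner_integrable_on_def by blast
  have x_eq: "integral S f = x" using HK[OF x] by (rule integral_unique)
  show "f integrable_on S" using HK[OF x] by blast
  show "has_Bochner_integral_on f (integral S f) S" using x x_eq by simp
  have "(THE x. has_Bochner_integral_on f x S) = x"
    using x HK by (intro the_equality) (auto dest: has_integral_unique)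
  then show "Bochner_integral_on S f = integral S f"
    using assms x_eq by (simp add: Bochner_integral_on_def)
qed

section \<open>Dominated convergence for vector-valued integrals\<close>

lemma integrable_on_borel_dominated:
  fixes h :: "'n::euclidean_space \<Rightarrow> real"
  assumes "h \<in> borel_measurable borel" "S \<in> sets borel" "g integrable_on S"
    and "\<And>x. x \<in> S \<Longrightarrow> \<bar>h x\<bar> \<le> g x"
  shows "h integrable_on S"
proof (rule measurable_bounded_by_integrable_imp_integrable_real[OF _ assms(3,4)])
  have "h \<in> borel_measurable lebesgue" using assms(1) by (simp add: borel_measurable_if measurable_completion)
  then show "h \<in> borel_measurable (lebesgue_on S)" by (rule measurable_restrict_space1)
  show "S \<in> sets lebesgue" using assms(2) by simp
qed auto

text \<open>The real dominated convergence theorem is applied to the norm of the difference, which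
  bounds the difference of the integrals. Extension by zero allows the domains \<open>A n\<close> to
  vary, as truncations require.\<close>

lemma tendsto_integral_dominated:
  fixes f :: "real \<Rightarrow> 'b::banach"
  assumes f: "continuous_on S f" "f integrable_on S" and S: "S \<in> sets borel"
    and A: "\<And>n. A n \<in> sets borel" "\<And>n. A n \<subseteq> S"
    and g: "\<And>n. continuous_on (A n) (g n)" "\<And>n. g n integrable_on A n"
    and h: "h integrable_on S" "\<And>t. t \<in> S \<Longrightarrow> norm (f t) \<le> h t"
      "\<And>n t. t \<in> A n \<Longrightarrow> norm (g n t) \<le> h t"
    and lim: "\<And>t. t \<in> S \<Longrightarrow> (\<lambda>n. indicator (A n) t *\<^sub>R g n t) \<longlonglongrightarrow> f t"
  shows "(\<lambda>n. integral (A n) (g n)) \<longlonglongrightarrow> integral S f"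
proof -
  define G where "G = (\<lambda>n t. indicator (A n) t *\<^sub>R g n t)"
  have G: "(G n has_integral integral (A n) (g n)) S" for n
  proof -
    have "G n = (\<lambda>t. if t \<in> A n then g n t else 0)" by (auto simp: G_def indicator_def)
    then show ?thesis
      using has_integral_restrict[OF A(2)[of n], of "g n"] g(2) by (auto simp: integrable_integral)
  qed
  have bound: "norm (G n t - f t) \<le> h t + h t" if t: "t \<in> S" for n t
  proof -
    have "norm (G n t) \<le> h t"
      using h(3)[of t n] order_trans[OF norm_ge_zero h(2)[OF t]] by (auto simp: G_def indicator_def)
    then show ?thesis
      using norm_triangle_ineq4[of "G n t" "f t"] h(2)[OF t] by linarith
  qed
  have D: "(\<lambda>t. norm (G n t - f t)) integrable_on S" for n
  proof -
    \<comment> \<open>On \<open>S\<close> this is \<open>norm (G n t - f t)\<close>, but split over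
      \<open>A n\<close> and its complement in \<open>S\<close>. Each piece is continuous on its
      Borel set, which gives Borel measurability.\<close>
    define D where "D = (\<lambda>t. indicator (A n) t *\<^sub>R norm (g n t - f t) + indicator (S - A n) t *\<^sub>R norm (f t))"
    have D_eq: "D t = norm (G n t - f t)" if "t \<in> S" for t
      using that by (auto simp: D_def G_def indicator_def)
    have "D integrable_on S"
    proof (rule integrable_on_borel_dominated[OF _ S])
      show "D \<in> borel_measurable borel"
        unfolding D_def using A S g f(1)
        by (intro borel_measurable_add borel_measurable_continuous_on_indicator continuous_on_norm continuous_on_diff)
          (auto intro: continuous_on_subset)
      show "(\<lambda>t. h t + h t) integrable_on S" using h(1) by (intro integrable_add)
      fix t assume t: "t \<in> S"
      show "\<bar>D t\<bar> \<le> h t + h t"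
        using bound[OF t, of n] by (simp add: D_eq[OF t])
    qed
    then show ?thesis by (rule integrable_eq) (rule D_eq)
  qed
  have "(\<lambda>n. integral S (\<lambda>t. norm (G n t - f t))) \<longlonglongrightarrow> integral S (\<lambda>t. 0::real)"
  proof (rule dominated_convergence(2)[OF D])
    show "(\<lambda>t. h t + h t) integrable_on S" using h(1) by (intro integrable_add)
    fix t assume t: "t \<in> S"
    show "norm (norm (G n t - f t)) \<le> h t + h t" for n
      using bound[OF t, of n] by simp
    show "(\<lambda>n. norm (G n t - f t)) \<longlonglongrightarrow> 0"
      using lim[OF t] unfolding G_def by (intro tendsto_norm_zero LIM_zero)
  qed
  then have lim0: "(\<lambda>n. integral S (\<lambda>t. norm (G n t - f t))) \<longlonglongrightarrow> 0" by simp
  have "norm (integral (A n) (g n) - integral S f) \<le> integral S (\<lambda>t. norm (G n t - f t))" for n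
  proof -
    have i: "((\<lambda>t. G n t - f t) has_integral integral (A n) (g n) - integral S f) S"
      using G f(2) by (intro has_integral_diff) auto
    then show ?thesis
      using integral_norm_bound_integral[OF has_integral_integrable[OF i] D] integral_unique[OF i] by auto
  qed
  then have "(\<lambda>n. integral (A n) (g n) - integral S f) \<longlonglongrightarrow> 0"
    by (intro Lim_null_comparison[OF _ lim0] always_eventually) auto
  then show ?thesis by (rule LIM_zero_cancel)
qed

section \<open>Bochner integrability of continuous dominated functions\<close>

text \<open>These compact intervals exhaust the open half-line while staying away from the possible
  singularity at 0; all truncations between 0 and infinity below use them.\<close>

lemma eventually_mem_Icc_inverse:
  assumes "0 < (t::real)"
  shows "eventually (\<lambda>n. t \<in> {inverse (real (Suc n))..real (Suc n)}) sequentially"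
proof -
  obtain n1 where n1: "inverse (real (Suc n1)) < t" using reals_Archimedean[OF assms] by auto
  obtain n2 where n2: "t < real n2" using reals_Archimedean2 by auto
  have "t \<in> {inverse (real (Suc n))..real (Suc n)}" if "n \<ge> max n1 n2" for n
  proof -
    have "inverse (real (Suc n)) \<le> inverse (real (Suc n1))"
      using that by (intro le_imp_inverse_le) auto
    moreover have "real n2 \<le> real (Suc n)" using that by simp
    ultimately show ?thesis using n1 n2 unfolding atLeastAtMost_iff by linarith
  qed
  then show ?thesis unfolding eventually_sequentially by blast
qed

text \<open>Sample \<open>f\<close> at the grid point to the left of \<open>t\<close>, replaced by
  \<open>a\<close> if it falls below the interval. Uniform continuity bounds the error, and only
  finitely many grid points occur.\<close>

lemma continuous_on_Icc_step_approx:
  fixes f :: "real \<Rightarrow> 'b::real_normed_vector"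
  assumes f: "continuous_on {a..b} f" and a: "0 < a" and e: "e > 0"
  obtains s where "Bochner_Integration.simple_bochner_integrable lborel s"
    "\<And>t. t \<notin> {a..b} \<Longrightarrow> s t = 0" "\<And>t. t \<in> {a..b} \<Longrightarrow> norm (f t - s t) \<le> e"
proof -
  have "uniformly_continuous_on {a..b} f"
    using f by (intro compact_uniformly_continuous) auto
  then obtain d where d: "d > 0"
    "\<And>x y. x \<in> {a..b} \<Longrightarrow> y \<in> {a..b} \<Longrightarrow> dist x y < d \<Longrightarrow> dist (f x) (f y) < e"
    unfolding uniformly_continuous_on_def using e by metis
  define \<delta> where "\<delta> = d / 2"
  have \<delta>: "\<delta> > 0" "\<delta> < d" using d(1) by (auto simp: \<delta>_def)
  \<comment> \<open>Since \<open>a > 0\<close>, the value \<open>0\<close> of \<open>\<phi>\<close> marks the points outside \<open>{a..b}\<close>.\<close>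
  define \<phi> where "\<phi> = (\<lambda>t. indicator {a..b} t *\<^sub>R max a (\<delta> * real_of_int \<lfloor>t / \<delta>\<rfloor>))"
  define s where "s = (\<lambda>t. if \<phi> t = 0 then 0 else f (\<phi> t))"
  have near: "\<phi> t \<in> {a..b} \<and> dist t (\<phi> t) < d" if t: "t \<in> {a..b}" for t
  proof -
    have "\<delta> * real_of_int \<lfloor>t / \<delta>\<rfloor> \<le> t" "t - \<delta> < \<delta> * real_of_int \<lfloor>t / \<delta>\<rfloor>"
      using \<delta>(1) mult_left_mono[of "real_of_int \<lfloor>t / \<delta>\<rfloor>" "t / \<delta>" \<delta>]
        mult_strict_left_mono[OF floor_correct[of "t / \<delta>", THEN conjunct2] \<delta>(1)]
      by (simp_all add: algebra_simps)
    then show ?thesis using t \<delta> by (auto simp: \<phi>_def dist_real_def)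
  qed
  have s_eq: "s t = f (\<phi> t)" if "t \<in> {a..b}" for t
    using near[OF that] a by (auto simp: s_def)
  have s_0: "s t = 0" if "t \<notin> {a..b}" for t
    using that by (auto simp: s_def \<phi>_def)
  have "range \<phi> \<subseteq> insert 0 ((\<lambda>i. max a (\<delta> * real_of_int i)) ` {\<lfloor>a / \<delta>\<rfloor>..\<lfloor>b / \<delta>\<rfloor>})"
  proof safe
    fix t assume ne: "\<phi> t \<notin> (\<lambda>i. max a (\<delta> * real_of_int i)) ` {\<lfloor>a / \<delta>\<rfloor>..\<lfloor>b / \<delta>\<rfloor>}"
    show "\<phi> t = 0"
    proof (cases "t \<in> {a..b}")
      case True
      then have "\<lfloor>t / \<delta>\<rfloor> \<in> {\<lfloor>a / \<delta>\<rfloor>..\<lfloor>b / \<delta>\<rfloor>}"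
        using \<delta> by (auto intro!: floor_mono divide_right_mono)
      then have "\<phi> t \<in> (\<lambda>i. max a (\<delta> * real_of_int i)) ` {\<lfloor>a / \<delta>\<rfloor>..\<lfloor>b / \<delta>\<rfloor>}"
        using True by (auto simp: \<phi>_def)
      then show ?thesis using ne by simp
    qed (simp add: \<phi>_def)
  qed
  then have "finite (range \<phi>)" by (rule finite_subset) simp
  moreover have "\<phi> \<in> borel_measurable borel" unfolding \<phi>_def by measurable
  ultimately have "simple_function lborel \<phi>" by (intro simple_function_borel_measurable) auto
  then have s_simple: "simple_function lborel s"
    unfolding s_def by (rule simple_function_compose1)
  have "emeasure lborel {t. s t \<noteq> 0} \<le> emeasure lborel {a..b}"
  proof (rule emeasure_mono)
    show "{t. s t \<noteq> 0} \<subseteq> {a..b}" using s_0 by blast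
  qed simp
  also have "\<dots> < \<infinity>" by (simp add: emeasure_lborel_Icc_eq)
  finally have "Bochner_Integration.simple_bochner_integrable lborel s"
    by (intro Bochner_Integration.simple_bochner_integrable.intros s_simple) auto
  moreover have "norm (f t - s t) \<le> e" if "t \<in> {a..b}" for t
    using d(2)[OF that] near[OF that] by (auto simp: s_eq[OF that] dist_norm intro: less_imp_le)
  ultimately show ?thesis using that s_0 by blast
qed

text \<open>Split the half-line into a compact interval \<open>K n\<close>, where a step function is
  uniformly close to \<open>f\<close>, and a tail, whose integral tends to 0 by dominated
  convergence.\<close>

lemma Bochner_integrable_on_continuous_dominated:
  fixes f :: "real \<Rightarrow> 'b::banach"
  assumes f: "continuous_on {0<..} f" and g: "g integrable_on {0<..}"
    and le: "\<And>t. t > 0 \<Longrightarrow> norm (f t) \<le> g t"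
  shows "Bochner_integrable_on f {0<..}"
  unfolding Bochner_integrable_on_def has_Bochner_integral_on_def
proof (rule has_Bochner_integral_if_simple_approx)
  show "(\<lambda>t. indicator {0<..} t *\<^sub>R f t) \<in> borel_measurable lborel"
    using borel_measurable_continuous_on_indicator[OF _ f] by simp
  fix e :: real assume e: "e > 0"
  define K where "K = (\<lambda>n. {inverse (real (Suc n))..real (Suc n)})"
  have K: "K n \<subseteq> {0<..}" for n by (auto simp: K_def intro: less_le_trans[rotated])
  define tail where "tail = (\<lambda>n t. indicator ({0<..} - K n) t *\<^sub>R norm (f t))"
  have tail_meas: "tail n \<in> borel_measurable borel" for n
    unfolding tail_def using f
    by (intro borel_measurable_continuous_on_indicator continuous_on_norm)
      (auto simp: K_def intro: continuous_on_subset)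
  have tail_int: "tail n integrable_on {0<..}" for n
    using le by (intro integrable_on_borel_dominated[OF tail_meas _ g])
      (auto simp: tail_def indicator_def intro: order_trans[OF norm_ge_zero])
  have "(\<lambda>n. integral {0<..} (tail n)) \<longlonglongrightarrow> integral {0<..} (\<lambda>t::real. 0::real)"
  proof (rule dominated_convergence(2)[OF tail_int g])
    fix t :: real assume t: "t \<in> {0<..}"
    show "norm (tail n t) \<le> g t" for n
      using le[of t] t by (auto simp: tail_def indicator_def intro: order_trans[OF norm_ge_zero])
    have "eventually (\<lambda>n. tail n t = 0) sequentially"
      using eventually_mem_Icc_inverse[of t] t by (auto simp: tail_def K_def elim: eventually_mono)
    then show "(\<lambda>n. tail n t) \<longlonglongrightarrow> 0" by (rule tendsto_eventually)
  qed
  then have "eventually (\<lambda>n. integral {0<..} (tail n) < e/2) sequentially"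
    using e by (intro order_tendstoD(2)) auto
  then obtain n where n: "integral {0<..} (tail n) < e/2" by (auto simp: eventually_sequentially)
  \<comment> \<open>The length of \<open>K n\<close> is at most \<open>Suc n\<close>, so a uniform
    error \<eta> on it costs at most \<open>e/2\<close>; the tail costs less than the other
    half.\<close>
  define \<eta> where "\<eta> = e / (2 * real (Suc n))"
  have "\<eta> > 0" using e by (simp add: \<eta>_def)
  have cont_K: "continuous_on (K n) f" using f K by (rule continuous_on_subset)
  have pos: "0 < inverse (real (Suc n))" by simp
  obtain s where s: "Bochner_Integration.simple_bochner_integrable lborel s"
    "\<And>t. t \<notin> K n \<Longrightarrow> s t = 0" "\<And>t. t \<in> K n \<Longrightarrow> norm (f t - s t) \<le> \<eta>"
    using continuous_on_Icc_step_approx[OF cont_K[unfolded K_def] pos \<open>\<eta> > 0\<close>] unfolding K_def by blast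
  \<comment> \<open>A pointwise majorant of the approximation error: \<eta> on \<open>K n\<close>,
    and \<open>norm (f t)\<close> off it, where \<open>s\<close> vanishes.\<close>
  define H where "H = (\<lambda>t. indicator (K n) t *\<^sub>R \<eta> + tail n t)"
  have tail_UNIV: "(tail n has_integral integral {0<..} (tail n)) UNIV"
  proof -
    have "tail n = (\<lambda>t. if t \<in> {0<..} then tail n t else 0)" by (auto simp: tail_def indicator_def)
    then show ?thesis
      using has_integral_restrict_UNIV[of "{0<..}" "tail n"] tail_int[of n] by (metis integrable_integral)
  qed
  have K_UNIV: "((\<lambda>t. indicator (K n) t *\<^sub>R \<eta>) has_integral measure lborel (K n) * \<eta>) UNIV"
  proof -
    have "((\<lambda>t. 1) has_integral measure lborel (K n)) (K n)"
      by (rule has_integral_measure_lborel) (auto simp: K_def emeasure_lborel_Icc_eq)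
    then have "((\<lambda>t. indicat_real (K n) t) has_integral measure lborel (K n)) UNIV"
      by (subst (asm) has_integral_restrict_UNIV[symmetric]) (simp add: indicator_def of_bool_def)
    then show ?thesis unfolding real_scaleR_def by (rule has_integral_mult_left)
  qed
  have "(\<integral>\<^sup>+t. ennreal (norm (indicator {0<..} t *\<^sub>R f t - s t)) \<partial>lborel) \<le> (\<integral>\<^sup>+t. ennreal (H t) \<partial>lborel)"
    using s(2,3) K[of n]
    by (intro nn_integral_mono ennreal_leI) (auto simp: H_def tail_def indicator_def)
  also have "\<dots> = ennreal (measure lborel (K n) * \<eta> + integral {0<..} (tail n))"
  proof (rule nn_integral_has_integral_lborel)
    show "H \<in> borel_measurable borel"
      unfolding H_def using tail_meas by (intro borel_measurable_add) (auto simp: K_def)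
    show "0 \<le> H t" for t using \<open>\<eta> > 0\<close> by (auto simp: H_def tail_def indicator_def)
    show "(H has_integral measure lborel (K n) * \<eta> + integral {0<..} (tail n)) UNIV"
      unfolding H_def by (intro has_integral_add K_UNIV tail_UNIV)
  qed
  also have "\<dots> < ennreal e"
  proof (rule ennreal_lessI[OF e])
    have "measure lborel (K n) \<le> real (Suc n)" by (simp add: K_def content_real_if)
    then have "measure lborel (K n) * \<eta> \<le> real (Suc n) * \<eta>"
      using \<open>\<eta> > 0\<close> by (intro mult_right_mono) auto
    also have "\<dots> = e/2" by (simp add: \<eta>_def field_simps)
    finally show "measure lborel (K n) * \<eta> + integral {0<..} (tail n) < e" using n by linarith
  qed
  finally show "\<exists>s. Bochner_Integration.simple_bochner_integrable lborel s \<and>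
      (\<integral>\<^sup>+y. ennreal (norm (indicator {0<..} y *\<^sub>R f y - s y)) \<partial>lborel) < ennreal e"
    using s(1) by blast
qed

lemma Bochner_integral_on_cong:
  assumes "\<And>t. t \<in> S \<Longrightarrow> f t = g t"
  shows "Bochner_integral_on S f = Bochner_integral_on S g"
proof -
  have "(\<lambda>t. indicator S t *\<^sub>R f t) = (\<lambda>t. indicator S t *\<^sub>R g t)"
    by (rule ext) (auto simp: assms split: split_indicator)
  then show ?thesis
    by (simp add: Bochner_integral_on_def Bochner_integrable_on_def has_Bochner_integral_on_def)
qed

lemma integrable_on_Ici_iff_Ioi:
  fixes f :: "real \<Rightarrow> 'b::banach"
  shows "f integrable_on {a..} \<longleftrightarrow> f integrable_on {a<..}" "integral {a..} f = integral {a<..} f"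
proof -
  have *: "(f has_integral x) {a..} \<longleftrightarrow> (f has_integral x) {a<..}" for x
    by (rule has_integral_spike_set_eq) (auto intro: negligible_subset[of "{a}"])
  show "f integrable_on {a..} \<longleftrightarrow> f integrable_on {a<..}" by (simp add: integrable_on_def *)
  then show "integral {a..} f = integral {a<..} f"
    using * by (metis integrable_integral integral_unique not_integrable_integral)
qed

section \<open>Gamma integrals\<close>

text \<open>On positive reals the function is the norm of the complex Gamma integrand, which is
  absolutely integrable.\<close>

lemma integrable_on_powr_times_exp:
  assumes "s > 0" "c > (0::real)"
  shows "(\<lambda>t. t powr (s - 1) * exp (- c * t)) integrable_on {0<..}"
proof -
  have "(\<lambda>t. complex_of_real t powr (complex_of_real s - 1) / of_real (exp (c * t)))
      absolutely_integrable_on {0<..}"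
    using assms by (intro absolutely_integrable_Gamma_integral) auto
  then have "(\<lambda>t. norm (complex_of_real t powr (complex_of_real s - 1) / of_real (exp (c * t))))
      integrable_on {0<..}"
    by (simp add: absolutely_integrable_on_def)
  then show ?thesis
  proof (rule integrable_eq)
    fix t :: real assume "t \<in> {0<..}"
    then show "norm (complex_of_real t powr (complex_of_real s - 1) / of_real (exp (c * t)))
        = t powr (s - 1) * exp (- c * t)"
      by (simp add: norm_divide norm_powr_real_powr exp_minus field_simps)
  qed
qed

lemma has_integral_Gamma:
  assumes "s > (0::real)"
  shows "((\<lambda>t. t powr (s - 1) * exp (- t)) has_integral Gamma s) {0<..}"
proof -
  have "((\<lambda>t. t powr (s - 1) / exp t) has_integral Gamma s) {0..}"
    using assms by (rule Gamma_integral_real)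
  then have "((\<lambda>t. t powr (s - 1) / exp t) has_integral Gamma s) {0<..}"
    by (rule has_integral_spike_set_eq[THEN iffD1, rotated 2])
      (auto intro: negligible_subset[of "{0}"])
  then show ?thesis by (simp add: exp_minus field_simps)
qed

text \<open>Substitute v = t / \<mu>. The map is decreasing, so the endpoints are exchanged and its
  derivative is negative.\<close>

lemma integral_powr_times_exp_inverse:
  fixes t a b s :: real
  assumes t: "t > 0" and ab: "0 < a" "a \<le> b"
  shows "integral {a..b} (\<lambda>\<mu>. \<mu> powr (s - 2) * exp (- (t / \<mu>))) =
    t powr (s - 1) * integral {t/b..t/a} (\<lambda>v. v powr (- s) * exp (- v))"
proof -
  let ?f = "\<lambda>v. v powr (- s) * exp (- v)"
  have pos: "0 < t/b" using t ab by simp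
  have "((\<lambda>\<mu>. (- (t / \<mu>\<^sup>2)) *\<^sub>R ?f (t / \<mu>)) has_integral
      (integral {t/a..t/b} ?f - integral {t/b..t/a} ?f)) {a..b}"
  proof (rule has_integral_substitution_general[where s = "{}" and c = "t/b" and d = "t/a"])
    show "(\<lambda>\<mu>. t / \<mu>) ` {a..b} \<subseteq> {t/b..t/a}"
      using t ab by (auto intro!: divide_left_mono)
    show "continuous_on {t/b..t/a} ?f"
      using pos by (intro continuous_intros) auto
    show "continuous_on {a..b} (\<lambda>\<mu>. t / \<mu>)"
      using ab by (intro continuous_intros) auto
    show "((\<lambda>\<mu>. t / \<mu>) has_field_derivative - (t / \<mu>\<^sup>2)) (at \<mu> within {a..b})"
      if "\<mu> \<in> {a..b} - {}" for \<mu>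
      using that ab by (auto intro!: derivative_eq_intros simp: power2_eq_square)
  qed (use ab in auto)
  \<comment> \<open>The interval is empty, or a single point if a = b; only the oppositely oriented
    integral survives.\<close>
  moreover have "integral {t/a..t/b} ?f = 0"
  proof (cases "a = b")
    case False
    then have "t/b < t/a" using t ab by (simp add: divide_strict_left_mono)
    then show ?thesis by simp
  qed simp
  \<comment> \<open>The factor removes the sign and all powers of \<open>t\<close>: t^(s-1) * t /
    \<mu>^2 * (t/\<mu>)^(-s) = \<mu>^(s-2).\<close>
  ultimately have "((\<lambda>\<mu>. - (t powr (s - 1)) * ((- (t / \<mu>\<^sup>2)) *\<^sub>R ?f (t / \<mu>))) has_integral
      - (t powr (s - 1)) * (- integral {t/b..t/a} ?f)) {a..b}"
    by (intro has_integral_mult_right) simp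
  then have "((\<lambda>\<mu>. \<mu> powr (s - 2) * exp (- (t / \<mu>))) has_integral
      - (t powr (s - 1)) * (- integral {t/b..t/a} ?f)) {a..b}"
  proof (rule has_integral_eq[rotated])
    fix \<mu> assume "\<mu> \<in> {a..b}"
    then have \<mu>: "\<mu> > 0" using ab by auto
    have "t powr (s - 1) * (t / \<mu>\<^sup>2) * (t / \<mu>) powr (- s) = \<mu> powr (s - 2)"
    proof -
      have "(t / \<mu>) powr (- s) = t powr (- s) * \<mu> powr s"
        using t \<mu> by (simp add: powr_divide powr_minus field_simps)
      moreover have "t powr (s - 1) * t = t powr s"
        using t by (simp add: powr_diff)
      moreover have "\<mu> powr s / \<mu>\<^sup>2 = \<mu> powr (s - 2)"
        using \<mu> by (simp add: powr_diff)
      moreover have "t powr s * t powr (- s) = 1"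
        using t by (simp add: powr_minus)
      ultimately show ?thesis
        by (simp add: field_simps)
    qed
    moreover have "- (t powr (s - 1)) * ((- (t / \<mu>\<^sup>2)) *\<^sub>R ?f (t / \<mu>)) =
        t powr (s - 1) * (t / \<mu>\<^sup>2) * (t / \<mu>) powr (- s) * exp (- (t / \<mu>))"
      by simp
    ultimately show "- (t powr (s - 1)) * ((- (t / \<mu>\<^sup>2)) *\<^sub>R ?f (t / \<mu>)) = \<mu> powr (s - 2) * exp (- (t / \<mu>))"
      by simp
  qed
  then show ?thesis by (simp add: integral_unique)
qed

text \<open>The substitution turns these integrals into truncations of the integral for
  \<open>Gamma (1 - s)\<close>. Its integrand is nonnegative, which gives the bound; the truncated
  intervals exhaust the half-line, which gives the limit.\<close>

lemma
  fixes t s :: real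
  assumes t: "t > 0" and s: "s < 1"
  shows integral_powr_times_exp_inverse_le:
      "integral {inverse (real (Suc n))..real (Suc n)} (\<lambda>\<mu>. \<mu> powr (s - 2) * exp (- (t / \<mu>)))
        \<le> Gamma (1 - s) * t powr (s - 1)"
    and tendsto_integral_powr_times_exp_inverse:
      "(\<lambda>n. integral {inverse (real (Suc n))..real (Suc n)} (\<lambda>\<mu>. \<mu> powr (s - 2) * exp (- (t / \<mu>))))
        \<longlonglongrightarrow> Gamma (1 - s) * t powr (s - 1)"
proof -
  let ?f = "\<lambda>v::real. v powr (- s) * exp (- v)"
  define A where "A = (\<lambda>n. {t / real (Suc n)..t / inverse (real (Suc n))})"
  have Gamma: "(?f has_integral Gamma (1 - s)) {0<..}"
    using has_integral_Gamma[of "1 - s"] s by simp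
  have A_sub: "A n \<subseteq> {0<..}" for n
    using t by (auto simp: A_def intro: less_le_trans[rotated])
  have cont: "continuous_on (A n) ?f" for n
    using A_sub[of n] by (intro continuous_intros) auto
  have int: "?f integrable_on A n" for n
    using cont[of n] unfolding A_def by (rule integrable_continuous_interval)
  have eq: "integral {inverse (real (Suc n))..real (Suc n)} (\<lambda>\<mu>. \<mu> powr (s - 2) * exp (- (t / \<mu>)))
      = t powr (s - 1) * integral (A n) ?f" for n
    unfolding A_def
  proof (rule integral_powr_times_exp_inverse[OF t])
    show "inverse (real (Suc n)) \<le> real (Suc n)"
      using inverse_le_1_iff[of "real (Suc n)"] by linarith
  qed simp
  have "integral (A n) ?f \<le> integral {0<..} ?f" for n
    using Gamma by (intro integral_subset_le A_sub int) auto
  then have "integral (A n) ?f \<le> Gamma (1 - s)" for n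
    by (simp add: integral_unique[OF Gamma])
  then show "integral {inverse (real (Suc n))..real (Suc n)} (\<lambda>\<mu>. \<mu> powr (s - 2) * exp (- (t / \<mu>)))
        \<le> Gamma (1 - s) * t powr (s - 1)"
    unfolding eq by (subst mult.commute) (rule mult_right_mono, auto)
  have "(\<lambda>n. integral (A n) ?f) \<longlonglongrightarrow> integral {0<..} ?f"
  proof (rule tendsto_integral_dominated[where h = ?f])
    show "continuous_on {0<..} ?f" by (intro continuous_intros) auto
    show "A n \<in> sets borel" for n by (simp add: A_def)
    fix v :: real assume v: "v \<in> {0<..}"
    have "eventually (\<lambda>n. t/v \<in> {inverse (real (Suc n))..real (Suc n)}) sequentially"
      using t v by (intro eventually_mem_Icc_inverse) auto
    then have "eventually (\<lambda>n. v \<in> A n) sequentially"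
    proof (rule eventually_mono)
      fix n assume *: "t/v \<in> {inverse (real (Suc n))..real (Suc n)}"
      have "t / real (Suc n) \<le> v" using * v by (simp add: field_simps)
      moreover have "v \<le> t / inverse (real (Suc n))" using * v by (simp add: field_simps)
      ultimately show "v \<in> A n" by (simp add: A_def)
    qed
    then show "(\<lambda>n. indicator (A n) v *\<^sub>R ?f v) \<longlonglongrightarrow> ?f v"
      by (rule tendsto_eventually[OF eventually_mono]) simp
  qed (use Gamma A_sub cont int in auto)
  then have "(\<lambda>n. t powr (s - 1) * integral (A n) ?f) \<longlonglongrightarrow> t powr (s - 1) * Gamma (1 - s)"
    by (intro tendsto_mult_left) (simp add: integral_unique[OF Gamma])
  then show "(\<lambda>n. integral {inverse (real (Suc n))..real (Suc n)} (\<lambda>\<mu>. \<mu> powr (s - 2) * exp (- (t / \<mu>))))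
        \<longlonglongrightarrow> Gamma (1 - s) * t powr (s - 1)"
    unfolding eq by (simp add: mult.commute)
qed

text \<open>Dropping \<open>c\<close> from the denominator leaves \<mu>^(s-1), integrable at 0 since
  s > 0; dropping 1/\<mu> leaves \<mu>^(s-2) / c, integrable at infinity since s < 1.\<close>

lemma integrable_on_powr_divide:
  fixes s c :: real
  assumes s: "0 < s" "s < 1" and c: "c > 0"
  shows "(\<lambda>\<mu>. \<mu> powr (s - 2) / (1 / \<mu> + c)) integrable_on {0<..}"
proof -
  let ?g = "\<lambda>\<mu>. (if \<mu> \<in> {0..1} then \<mu> powr (s - 1) else 0) + (if \<mu> \<in> {1..} then \<mu> powr (s - 2) / c else 0)"
  have 1: "(\<lambda>\<mu>. if \<mu> \<in> {0..1} then \<mu> powr (s - 1) else 0) integrable_on UNIV"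
    using has_integral_powr_from_0[of "s - 1" 1] s
    unfolding integrable_restrict_UNIV by auto
  have "((\<lambda>\<mu>. \<mu> powr (s - 2) / c) integrable_on {1..})"
    using has_integral_powr_to_inf[of "s - 2" 1] s by (intro integrable_on_divide) auto
  then have 2: "(\<lambda>\<mu>. if \<mu> \<in> {1..} then \<mu> powr (s - 2) / c else 0) integrable_on UNIV"
    unfolding integrable_restrict_UNIV .
  define h where "h = (\<lambda>\<mu>. indicator {0<..} \<mu> *\<^sub>R (\<mu> powr (s - 2) / (1 / \<mu> + c)))"
  have "h integrable_on UNIV"
  proof (rule integrable_on_borel_dominated[OF _ _ integrable_add[OF 1 2]])
    show "h \<in> borel_measurable borel"
      unfolding h_def
    proof (intro borel_measurable_continuous_on_indicator continuous_intros)
      show "\<forall>\<mu>\<in>{0<..}. 1 / \<mu> + c \<noteq> 0"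
        using c by (metis add_pos_pos greaterThan_iff less_irrefl zero_less_divide_1_iff)
    qed auto
    fix \<mu> :: real
    show "\<bar>h \<mu>\<bar> \<le> ?g \<mu>"
    proof (cases "\<mu> > 0")
      case True
      have *: "1 / \<mu> + c > 0" using True c by (simp add: add_pos_pos)
      have "\<mu> powr (s - 2) / (1 / \<mu> + c) \<le> \<mu> powr (s - 2) / (1 / \<mu>)"
        using True c * by (intro divide_left_mono) auto
      also have "\<dots> = \<mu> powr (s - 1)"
      proof -
        have "\<mu> powr (s - 1) = \<mu> powr (s - 2) * \<mu> powr 1"
          by (subst powr_add[symmetric]) simp
        then show ?thesis using True by simp
      qed
      finally have a: "\<mu> powr (s - 2) / (1 / \<mu> + c) \<le> \<mu> powr (s - 1)" .
      have b: "\<mu> powr (s - 2) / (1 / \<mu> + c) \<le> \<mu> powr (s - 2) / c"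
        using True c * by (intro divide_left_mono) auto
      have "\<bar>h \<mu>\<bar> = \<mu> powr (s - 2) / (1 / \<mu> + c)"
        using True * by (simp add: h_def)
      moreover have "0 \<le> \<mu> powr (s - 2) / c" using c by simp
      ultimately show ?thesis using a b True by (cases "\<mu> \<le> 1") auto
    qed (use c in \<open>auto simp: h_def\<close>)
  qed auto
  moreover have "h = (\<lambda>\<mu>. if \<mu> \<in> {0<..} then \<mu> powr (s - 2) / (1 / \<mu> + c) else 0)"
    by (auto simp: h_def)
  ultimately show ?thesis using integrable_restrict_UNIV by metis
qed

text \<open>This disposes of the constant in the definition of \<open>frac_power\<close>; it follows
  from the complex reflection formula at a real argument.\<close>

lemma Gamma_reflection_real:
  fixes s :: real
  assumes "0 < s" "s < 1"
  shows "sin (s * pi) / pi * Gamma (1 - s) = 1 / Gamma s"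
proof -
  have "complex_of_real (Gamma s * Gamma (1 - s)) = complex_of_real (pi / sin (pi * s))"
    using Gamma_reflection_complex[of "complex_of_real s"]
    by (simp add: Gamma_complex_of_real[symmetric] sin_of_real[symmetric])
  then have "Gamma s * Gamma (1 - s) = pi / sin (pi * s)"
    by (simp only: of_real_eq_iff)
  moreover have "sin (pi * s) > 0" using assms by (intro sin_gt_zero) auto
  moreover have "Gamma s > 0" using assms by (intro Gamma_real_pos)
  ultimately show ?thesis by (simp add: field_simps)
qed

section \<open>Exponentially stable semigroups and their resolvents\<close>

text \<open>The product rule at 0: multiplying the family by e^(-ct) shifts its generator by -c. A
  negative \<open>c\<close> undoes such a rescaling, and a constant family gives the derivative of
  the exponential.\<close>

lemma tendsto_rescaled_difference_quotient:
  fixes T :: "real \<Rightarrow> 'a::real_normed_vector \<Rightarrow> 'a"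
  assumes "((\<lambda>h. (T h u - u) /\<^sub>R h) \<longlongrightarrow> v) (at_right 0)"
  shows "((\<lambda>h. (exp (- c * h) *\<^sub>R T h u - u) /\<^sub>R h) \<longlongrightarrow> v - c *\<^sub>R u) (at_right 0)"
proof -
  have "((\<lambda>h. exp (- c * h)) has_real_derivative - c) (at 0 within {0<..})"
    by (auto intro!: derivative_eq_intros)
  then have d: "((\<lambda>h. (exp (- c * h) - 1) / h) \<longlongrightarrow> - c) (at_right 0)"
    by (simp add: has_field_derivative_iff)
  have "((\<lambda>h. exp (- c * h)) \<longlongrightarrow> exp (- c * 0)) (at_right 0)"
    by (intro tendsto_intros)
  then have "((\<lambda>h. exp (- c * h) *\<^sub>R ((T h u - u) /\<^sub>R h) + ((exp (- c * h) - 1) / h) *\<^sub>R u)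
      \<longlongrightarrow> exp (- c * 0) *\<^sub>R v + (- c) *\<^sub>R u) (at_right 0)"
    by (intro tendsto_add tendsto_scaleR assms d tendsto_const)
  moreover have "exp (- c * h) *\<^sub>R ((T h u - u) /\<^sub>R h) + ((exp (- c * h) - 1) / h) *\<^sub>R u
      = (exp (- c * h) *\<^sub>R T h u - u) /\<^sub>R h" for h
    by (simp add: divide_inverse scaleR_diff_right scaleR_diff_left algebra_simps)
  ultimately show ?thesis by simp
qed

lemma tendsto_generator:
  assumes "u \<in> generator_domain T"
  shows "((\<lambda>h. (T h u - u) /\<^sub>R h) \<longlongrightarrow> generator T u) (at_right 0)"
proof -
  obtain v where v: "((\<lambda>h. (T h u - u) /\<^sub>R h) \<longlongrightarrow> v) (at_right 0)"
    using assms by (auto simp: generator_domain_def)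
  then have "generator T u = v"
    unfolding generator_def by (intro tendsto_Lim) auto
  then show ?thesis using v by simp
qed

lemma generatorI:
  assumes "((\<lambda>h. (T h u - u) /\<^sub>R h) \<longlongrightarrow> v) (at_right 0)"
  shows "u \<in> generator_domain T" "generator T u = v"
  using assms tendsto_Lim[OF _ assms] by (auto simp: generator_domain_def generator_def)

section \<open>Stable semigroups and the inverse of the generator\<close>

text \<open>The constants are parameters so that the rescaled semigroups e^(-rt) T(t) are instances
  too, with decay rate \<epsilon> + r; every fact about \<open>T\<close> is then available for
  them.\<close>

locale stable_semigroup =
  fixes T :: "real \<Rightarrow> 'a::banach \<Rightarrow> 'a" and M \<epsilon> :: real
  assumes C0: "C0_semigroup T" and M_pos: "M > 0" and \<epsilon>_pos: "\<epsilon> > 0"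
    and norm_le: "\<And>t u. t \<ge> 0 \<Longrightarrow> norm (T t u) \<le> M * exp (- \<epsilon> * t) * norm u"
begin

lemma bounded_linear_T: "t \<ge> 0 \<Longrightarrow> bounded_linear (T t)"
  using C0 by (simp add: C0_semigroup_def)

lemma T_0 [simp]: "T 0 u = u"
  using C0 by (simp add: C0_semigroup_def)

lemma T_T: "t1 \<ge> 0 \<Longrightarrow> t2 \<ge> 0 \<Longrightarrow> T t1 (T t2 u) = T (t1 + t2) u"
  using C0 unfolding C0_semigroup_def by (metis comp_apply)

lemma T_commute: "t1 \<ge> 0 \<Longrightarrow> t2 \<ge> 0 \<Longrightarrow> T t1 (T t2 u) = T t2 (T t1 u)"
  by (simp add: T_T add.commute)

lemma norm_T_le: "t \<ge> 0 \<Longrightarrow> norm (T t u) \<le> M * norm u"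
proof -
  assume t: "t \<ge> 0"
  have "M * exp (- \<epsilon> * t) * norm u \<le> M * 1 * norm u"
    using M_pos \<epsilon>_pos t by (intro mult_right_mono mult_left_mono) auto
  with norm_le[OF t, of u] show ?thesis by simp
qed

text \<open>For t' < t the difference is T(t') applied to T(t-t')u - u, and T(t') has norm at most
  \<open>M\<close>. Factoring out the smaller time handles left and right continuity at
  once.\<close>

lemma continuous_on_T: "continuous_on {0..} (\<lambda>t. T t u)"
  unfolding continuous_on_iff
proof (intro ballI allI impI)
  fix t0 e :: real assume t0: "t0 \<in> {0..}" and "e > 0"
  then have "e / M > 0" using M_pos by simp
  have "((\<lambda>t. T t u) \<longlongrightarrow> u) (at_right 0)" using C0 by (simp add: C0_semigroup_def)
  then have "eventually (\<lambda>t. dist (T t u) u < e / M) (at_right 0)"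
    using \<open>e / M > 0\<close> by (rule tendstoD)
  then obtain d where d: "d > 0" "\<And>t. 0 < t \<Longrightarrow> t < d \<Longrightarrow> norm (T t u - u) < e / M"
    by (auto simp: eventually_at_right_field dist_norm)
  have close: "norm (T t u - T t' u) < e" if "0 \<le> t'" "t' < t" "t < t' + d" for t t'
  proof -
    have "T t u - T t' u = T t' (T (t - t') u - u)"
      using that by (simp add: bounded_linear.linear[OF bounded_linear_T] linear_diff T_T)
    also have "norm \<dots> \<le> M * norm (T (t - t') u - u)"
      using that by (intro norm_T_le)
    also have "\<dots> < M * (e / M)"
      using that M_pos by (intro mult_strict_left_mono d(2)) auto
    finally show ?thesis using M_pos by simp
  qed
  show "\<exists>d>0. \<forall>t\<in>{0..}. dist t t0 < d \<longrightarrow> dist (T t u) (T t0 u) < e"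
  proof (intro exI conjI ballI impI, rule d(1))
    fix t assume t: "t \<in> {0..}" "dist t t0 < d"
    consider "t = t0" | "t < t0" | "t0 < t" by linarith
    then show "dist (T t u) (T t0 u) < e"
    proof cases
      case 1 then show ?thesis using \<open>e > 0\<close> by simp
    next
      case 2 then show ?thesis
        using close[of t t0] t by (auto simp: dist_norm norm_minus_commute)
    next
      case 3 then show ?thesis
        using close[of t0 t] t t0 by (auto simp: dist_norm)
    qed
  qed
qed

text \<open>This is the inverse of -L: \<open>tendsto_difference_quotient_potential\<close> and
  \<open>potential_generator\<close> show that it inverts -L from both sides.\<close>

definition potential :: "'a \<Rightarrow> 'a" where
  "potential u = integral {0..} (\<lambda>t. T t u)"

lemma has_integral_dominating:
  "((\<lambda>t. M * exp (- \<epsilon> * t) * norm u) has_integral M / \<epsilon> * norm u) {0..}"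
proof -
  have "((\<lambda>t. exp (- \<epsilon> * t)) has_integral 1 / \<epsilon>) {0..}"
    using has_integral_exp_minus_to_infinity[OF \<epsilon>_pos, of 0] by simp
  from has_integral_mult_left[OF has_integral_mult_right[OF this, of M], of "norm u"]
  show ?thesis by simp
qed

lemma integrable_T: "(\<lambda>t. T t u) integrable_on {0..}"
proof -
  have "(\<lambda>t. M * exp (- \<epsilon> * t) * norm u) integrable_on {0..}"
    using has_integral_dominating by blast
  then have "(\<lambda>t. M * exp (- \<epsilon> * t) * norm u) integrable_on {0<..}"
    by (rule integrable_spike_set) (auto intro: negligible_subset[of "{0}"])
  then have "Bochner_integrable_on (\<lambda>t. T t u) {0<..}"
    using norm_le continuous_on_subset[OF continuous_on_T Ioi_le_Ico]
    by (intro Bochner_integrable_on_continuous_dominated[where g = "\<lambda>t. M * exp (- \<epsilon> * t) * norm u"]) auto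
  then have "(\<lambda>t. T t u) integrable_on {0<..}"
    by (rule Bochner_integral_on_eq_integral(1))
  then show ?thesis
    by (rule integrable_spike_set) (auto intro: negligible_subset[of "{0}"])
qed

lemma norm_potential_le: "norm (potential u) \<le> M / \<epsilon> * norm u"
  unfolding potential_def
proof (rule order_trans[OF integral_norm_bound_integral])
  show "(\<lambda>t. T t u) integrable_on {0..}" by (rule integrable_T)
  show "(\<lambda>t. M * exp (- \<epsilon> * t) * norm u) integrable_on {0..}"
    using has_integral_dominating by blast
  show "integral {0..} (\<lambda>t. M * exp (- \<epsilon> * t) * norm u) \<le> M / \<epsilon> * norm u"
    by (simp only: integral_unique[OF has_integral_dominating] order_refl)
qed (use norm_le in auto)

lemma bounded_linear_potential: "bounded_linear potential"
proof (rule bounded_linear_intro)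
  fix u v :: 'a and c :: real
  have "integral {0..} (\<lambda>t. T t (u + v)) = integral {0..} (\<lambda>t. T t u + T t v)"
    by (intro integral_cong) (auto simp: linear_add bounded_linear.linear[OF bounded_linear_T])
  then show "potential (u + v) = potential u + potential v"
    unfolding potential_def by (simp add: integral_add integrable_T)
  have "integral {0..} (\<lambda>t. T t (c *\<^sub>R u)) = integral {0..} (\<lambda>t. c *\<^sub>R T t u)"
    by (intro integral_cong) (auto simp: linear_scale bounded_linear.linear[OF bounded_linear_T])
  then show "potential (c *\<^sub>R u) = c *\<^sub>R potential u"
    unfolding potential_def by simp
  show "norm (potential u) \<le> norm u * (M / \<epsilon>)"
    using norm_potential_le[of u] by (simp add: mult.commute)
qed

text \<open>The offset \<open>h\<close> is there because shifting the integration variable in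
  \<open>potential_T\<close> turns the upper limit n into n + h.\<close>

lemma tendsto_potential:
  assumes "h \<ge> 0"
  shows "(\<lambda>n. integral {0..real n + h} (\<lambda>t. T t u)) \<longlonglongrightarrow> potential u"
  unfolding potential_def
proof (rule tendsto_integral_dominated[where h = "\<lambda>t. M * exp (- \<epsilon> * t) * norm u"])
  show "(\<lambda>t. M * exp (- \<epsilon> * t) * norm u) integrable_on {0..}"
    using has_integral_dominating by blast
  show "continuous_on {0..real n + h} (\<lambda>t. T t u)" for n
    by (rule continuous_on_subset[OF continuous_on_T]) auto
  then show "(\<lambda>t. T t u) integrable_on {0..real n + h}" for n
    by (rule integrable_continuous_interval)
  fix t :: real assume t: "t \<in> {0..}"
  obtain N where N: "t < real N" using reals_Archimedean2 by blast
  have "eventually (\<lambda>n. t \<in> {0..real n + h}) sequentially"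
    unfolding eventually_sequentially
  proof (intro exI allI impI)
    fix n assume "N \<le> n"
    then have "real N \<le> real n" by simp
    then show "t \<in> {0..real n + h}" using N t assms by auto
  qed
  then show "(\<lambda>n. indicator {0..real n + h} t *\<^sub>R T t u) \<longlonglongrightarrow> T t u"
    by (rule tendsto_eventually[OF eventually_mono]) simp
qed (use norm_le continuous_on_T integrable_T in auto)

text \<open>By the semigroup law T(t)T(h) = T(t+h), so the integral is shifted by \<open>h\<close>
  and loses the part over [0,h]. The shift is made on truncated integrals, then n tends to
  infinity.\<close>

lemma potential_T:
  assumes h: "h \<ge> 0"
  shows "potential (T h u) = potential u - integral {0..h} (\<lambda>t. T t u)"
proof -
  have "integral {0..real n + 0} (\<lambda>t. T t (T h u)) =
      integral {0..real n + h} (\<lambda>t. T t u) - integral {0..h} (\<lambda>t. T t u)" for n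
  proof -
    have "(\<lambda>t. T t u) integrable_on {0..real n + h}"
      by (intro integrable_continuous_interval continuous_on_subset[OF continuous_on_T]) auto
    then have "integral {0..h} (\<lambda>t. T t u) + integral {h..real n + h} (\<lambda>t. T t u)
        = integral {0..real n + h} (\<lambda>t. T t u)"
      using h by (intro Henstock_Kurzweil_Integration.integral_combine) auto
    moreover have "integral {0..real n + 0} (\<lambda>t. T t (T h u)) = integral {0..real n + 0} (\<lambda>t. T (t + h) u)"
      using h by (intro integral_cong) (auto simp: T_T)
    moreover have "integral {h-h..(real n + h)-h} (\<lambda>t. T (t + h) u) = integral {h..real n + h} (\<lambda>t. T t u)"
      by (rule integral_shift_real_ivl)
    ultimately show ?thesis by (simp add: algebra_simps)
  qed
  then have "(\<lambda>n. integral {0..real n + h} (\<lambda>t. T t u) - integral {0..h} (\<lambda>t. T t u)) \<longlonglongrightarrow> potential (T h u)"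
    using tendsto_potential[of 0 "T h u"] by simp
  moreover have "(\<lambda>n. integral {0..real n + h} (\<lambda>t. T t u) - integral {0..h} (\<lambda>t. T t u))
      \<longlonglongrightarrow> potential u - integral {0..h} (\<lambda>t. T t u)"
    by (intro tendsto_diff tendsto_potential h tendsto_const)
  ultimately show ?thesis by (rule LIMSEQ_unique)
qed

lemma T_potential:
  assumes "h \<ge> 0"
  shows "T h (potential u) = potential (T h u)"
proof -
  have "T h (potential u) = integral {0..} (T h \<circ> (\<lambda>t. T t u))"
    unfolding potential_def using assms integrable_T bounded_linear_T
    by (intro integral_linear[symmetric]) auto
  also have "\<dots> = potential (T h u)"
    unfolding potential_def using assms by (intro integral_cong) (auto simp: T_commute)
  finally show ?thesis .
qed

text \<open>By \<open>T_potential\<close> and \<open>potential_T\<close> the quotient is minus the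
  mean of T(t)u over [0,h], which tends to -u by the fundamental theorem of calculus. Hence the
  potential maps into D(L).\<close>

lemma tendsto_difference_quotient_potential:
  "((\<lambda>h. (T h (potential u) - potential u) /\<^sub>R h) \<longlongrightarrow> - u) (at_right 0)"
proof -
  let ?F = "\<lambda>h. integral {0..h} (\<lambda>t. T t u)"
  have "(?F has_vector_derivative T 0 u) (at 0 within {0..1})"
    by (rule integral_has_vector_derivative) (auto intro: continuous_on_subset[OF continuous_on_T])
  then have "((\<lambda>h. (1 / norm (h - 0)) *\<^sub>R (?F h - (?F 0 + (h - 0) *\<^sub>R T 0 u))) \<longlongrightarrow> 0) (at_right 0)"
    unfolding has_vector_derivative_def has_derivative_within
    by (simp add: at_within_Icc_at_right)
  \<comment> \<open>With \<open>?F 0 = 0\<close> and h > 0, minus the differentiability remainder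
    minus \<open>u\<close> is exactly -F(h)/h.\<close>
  then have "((\<lambda>h. - ((1 / norm (h - 0)) *\<^sub>R (?F h - (?F 0 + (h - 0) *\<^sub>R T 0 u))) - u) \<longlongrightarrow> - 0 - u) (at_right 0)"
    by (intro tendsto_intros)
  then have "((\<lambda>h. - ((1 / norm (h - 0)) *\<^sub>R (?F h - (?F 0 + (h - 0) *\<^sub>R T 0 u))) - u) \<longlongrightarrow> - u) (at_right 0)"
    by simp
  then show ?thesis
  proof (rule Lim_transform_eventually)
    show "\<forall>\<^sub>F h in at_right 0. - ((1 / norm (h - 0)) *\<^sub>R (?F h - (?F 0 + (h - 0) *\<^sub>R T 0 u))) - u
        = (T h (potential u) - potential u) /\<^sub>R h"
      using eventually_at_right_less[of "0::real"]
    proof eventually_elim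
      case (elim h)
      then show ?case
        by (simp add: T_potential potential_T scaleR_diff_right scaleR_add_right divide_inverse)
    qed
  qed
qed

text \<open>The potential is bounded, so it passes inside the limit defining
  \<open>generator T x\<close>, and it commutes with the semigroup. The resulting quotient is that
  of \<open>potential x\<close>, whose limit is already known to be -x.\<close>

lemma potential_generator:
  assumes "x \<in> generator_domain T"
  shows "potential (generator T x) = - x"
proof -
  have "((\<lambda>h. potential ((T h x - x) /\<^sub>R h)) \<longlongrightarrow> potential (generator T x)) (at_right 0)"
    by (rule bounded_linear.tendsto[OF bounded_linear_potential tendsto_generator[OF assms]])
  moreover have "\<forall>\<^sub>F h in at_right 0. potential ((T h x - x) /\<^sub>R h) = (T h (potential x) - potential x) /\<^sub>R h"
    using eventually_at_right_less[of "0::real"]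
  proof eventually_elim
    case (elim h)
    then show ?case
      using bounded_linear.linear[OF bounded_linear_potential]
      by (simp add: linear_diff linear_scale T_potential)
  qed
  ultimately have "((\<lambda>h. (T h (potential x) - potential x) /\<^sub>R h) \<longlongrightarrow> potential (generator T x)) (at_right 0)"
    by (rule Lim_transform_eventually)
  from tendsto_unique[OF _ this tendsto_difference_quotient_potential] show ?thesis
    by simp
qed

lemma generator_scaleR:
  assumes "x \<in> generator_domain T"
  shows "c *\<^sub>R x \<in> generator_domain T" "generator T (c *\<^sub>R x) = c *\<^sub>R generator T x"
proof -
  have "((\<lambda>h. c *\<^sub>R ((T h x - x) /\<^sub>R h)) \<longlongrightarrow> c *\<^sub>R generator T x) (at_right 0)"
    by (intro tendsto_intros tendsto_generator assms)
  moreover have "\<forall>\<^sub>F h in at_right 0. c *\<^sub>R ((T h x - x) /\<^sub>R h) = (T h (c *\<^sub>R x) - c *\<^sub>R x) /\<^sub>R h"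
    using eventually_at_right_less[of "0::real"]
  proof eventually_elim
    case (elim h)
    then show ?case
      using linear_scale[OF bounded_linear.linear[OF bounded_linear_T[of h]]]
      by (simp add: scaleR_diff_right mult.commute)
  qed
  ultimately have "((\<lambda>h. (T h (c *\<^sub>R x) - c *\<^sub>R x) /\<^sub>R h) \<longlongrightarrow> c *\<^sub>R generator T x) (at_right 0)"
    by (rule Lim_transform_eventually)
  from generatorI[where T = T and u = "c *\<^sub>R x", OF this]
  show "c *\<^sub>R x \<in> generator_domain T" "generator T (c *\<^sub>R x) = c *\<^sub>R generator T x" .
qed

section \<open>Resolvents through rescaled semigroups\<close>

text \<open>The semigroup generated by L - rI. Its potential is the resolvent of L at
  \<open>r\<close>, so facts about potentials become facts about resolvents.\<close>

definition rescaled :: "real \<Rightarrow> real \<Rightarrow> 'a \<Rightarrow> 'a" where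
  "rescaled r t u = exp (- r * t) *\<^sub>R T t u"

lemma stable_semigroup_rescaled:
  assumes "r \<ge> 0"
  shows "stable_semigroup (rescaled r) M (\<epsilon> + r)"
proof
  show "C0_semigroup (rescaled r)"
    unfolding C0_semigroup_def
  proof (intro conjI allI impI)
    fix t :: real assume "t \<ge> 0"
    have "rescaled r t = (\<lambda>u. exp (- r * t) *\<^sub>R T t u)" by (auto simp: rescaled_def)
    then show "bounded_linear (rescaled r t)"
      using bounded_linear_T[OF \<open>t \<ge> 0\<close>]
      by (simp add: bounded_linear_compose[OF bounded_linear_scaleR_right])
  next
    show "rescaled r 0 = id" by (auto simp: rescaled_def)
  next
    fix t1 t2 :: real assume t: "t1 \<ge> 0" "t2 \<ge> 0"
    have "rescaled r t1 (rescaled r t2 u) = rescaled r (t1 + t2) u" for u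
      using linear_scale[OF bounded_linear.linear[OF bounded_linear_T[OF t(1)]]] t
      by (simp add: rescaled_def T_T mult_exp_exp algebra_simps)
    then show "rescaled r t1 \<circ> rescaled r t2 = rescaled r (t1 + t2)" by auto
  next
    fix u
    have "((\<lambda>t. exp (- r * t) *\<^sub>R T t u) \<longlongrightarrow> exp (- r * 0) *\<^sub>R u) (at_right 0)"
      using C0 by (intro tendsto_intros) (auto simp: C0_semigroup_def)
    then show "((\<lambda>t. rescaled r t u) \<longlongrightarrow> u) (at_right 0)" by (simp add: rescaled_def)
  qed
  show "norm (rescaled r t u) \<le> M * exp (- (\<epsilon> + r) * t) * norm u" if "t \<ge> 0" for t u
  proof -
    have "norm (rescaled r t u) = exp (- r * t) * norm (T t u)" by (simp add: rescaled_def)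
    also have "\<dots> \<le> exp (- r * t) * (M * exp (- \<epsilon> * t) * norm u)"
      by (intro mult_left_mono norm_le that) auto
    also have "\<dots> = M * exp (- (\<epsilon> + r) * t) * norm u"
      by (simp add: mult_exp_exp algebra_simps)
    finally show ?thesis .
  qed
qed (use M_pos \<epsilon>_pos assms in auto)

text \<open>For r \<ge> 0 this is the inverse of rI - L = rI + A; in particular
  \<open>resolvent 0\<close> is B.\<close>

definition resolvent :: "real \<Rightarrow> 'a \<Rightarrow> 'a" where
  "resolvent r u = integral {0..} (\<lambda>t. exp (- r * t) *\<^sub>R T t u)"

lemma resolvent_eq_potential:
  assumes "r \<ge> 0"
  shows "resolvent r = stable_semigroup.potential (rescaled r)"
  using stable_semigroup.potential_def[OF stable_semigroup_rescaled[OF assms]]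
  by (auto simp: resolvent_def rescaled_def)

lemma norm_resolvent_le: "r \<ge> 0 \<Longrightarrow> norm (resolvent r u) \<le> M / (\<epsilon> + r) * norm u"
  by (simp only: resolvent_eq_potential stable_semigroup.norm_potential_le[OF stable_semigroup_rescaled])

lemma bounded_linear_resolvent: "r \<ge> 0 \<Longrightarrow> bounded_linear (resolvent r)"
  by (simp only: resolvent_eq_potential stable_semigroup.bounded_linear_potential[OF stable_semigroup_rescaled])

lemma generator_resolvent:
  assumes "r \<ge> 0"
  shows "resolvent r u \<in> generator_domain T"
    "generator T (resolvent r u) = r *\<^sub>R resolvent r u - u"
proof -
  interpret S: stable_semigroup "rescaled r" M "\<epsilon> + r"
    using assms by (rule stable_semigroup_rescaled)
  \<comment> \<open>Multiplication by e^(rh) recovers \<open>T\<close>, so the rescaling lemma with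
    c = -r leads from the generator L - rI back to L.\<close>
  have "exp (- (- r) * h) *\<^sub>R rescaled r h v = T h v" for h v
    by (simp add: rescaled_def mult_exp_exp)
  with tendsto_rescaled_difference_quotient[where T = "rescaled r" and c = "- r",
      OF S.tendsto_difference_quotient_potential[of u]]
  have "((\<lambda>h. (T h (resolvent r u) - resolvent r u) /\<^sub>R h) \<longlongrightarrow> r *\<^sub>R resolvent r u - u) (at_right 0)"
    by (simp add: resolvent_eq_potential[OF assms])
  from generatorI[where T = T and u = "resolvent r u", OF this]
  show "resolvent r u \<in> generator_domain T"
    "generator T (resolvent r u) = r *\<^sub>R resolvent r u - u" .
qed

text \<open>On D(L) the rescaled semigroup has generator L - rI, so
  \<open>potential_generator\<close> for that semigroup is the claim.\<close>

lemma resolvent_generator: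
  assumes "r \<ge> 0" and x: "x \<in> generator_domain T"
  shows "resolvent r (generator T x - r *\<^sub>R x) = - x"
proof -
  interpret S: stable_semigroup "rescaled r" M "\<epsilon> + r"
    using assms(1) by (rule stable_semigroup_rescaled)
  have "((\<lambda>h. (rescaled r h x - x) /\<^sub>R h) \<longlongrightarrow> generator T x - r *\<^sub>R x) (at_right 0)"
    unfolding rescaled_def by (intro tendsto_rescaled_difference_quotient tendsto_generator x)
  note g = generatorI[where T = "rescaled r" and u = x, OF this]
  show ?thesis
    using S.potential_generator[OF g(1)] g(2) by (simp add: resolvent_eq_potential[OF assms(1)])
qed

lemma inj_on_generator: "inj_on (generator T) (generator_domain T)"
  using resolvent_generator[of 0] by (intro inj_onI) (metis minus_minus order_refl scaleR_zero_left diff_zero)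

text \<open>The term \<open>inv\<close> is determined only at values of an injective map, so
  injectivity of \<mu>I + B is shown first; then the right-hand side is verified to be a preimage of
  Bu.\<close>

lemma resolvent_identity:
  assumes "\<mu> > 0"
  shows "inv (\<lambda>x. \<mu> *\<^sub>R x + resolvent 0 x) (resolvent 0 u) = resolvent (1 / \<mu>) u /\<^sub>R \<mu>"
proof (rule inv_f_eq)
  let ?r = "1 / \<mu>"
  have r: "?r \<ge> 0" using assms by simp
  note lin0 = bounded_linear.linear[OF bounded_linear_resolvent[OF order_refl]]
  show "inj (\<lambda>x. \<mu> *\<^sub>R x + resolvent 0 x)"
  proof (rule injI)
    fix x y assume eq: "\<mu> *\<^sub>R x + resolvent 0 x = \<mu> *\<^sub>R y + resolvent 0 y"
    define z where "z = x - y"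
    have "\<mu> *\<^sub>R z + resolvent 0 z = 0"
      using eq by (simp add: z_def linear_diff[OF lin0] scaleR_diff_right algebra_simps)
    then have "\<mu> *\<^sub>R z = - resolvent 0 z" by (rule eq_neg_iff_add_eq_0[THEN iffD2])
    then have "?r *\<^sub>R (\<mu> *\<^sub>R z) = ?r *\<^sub>R (- resolvent 0 z)" by (rule arg_cong)
    \<comment> \<open>A kernel element equals -Bz/\<mu>, so it lies in D(L) and satisfies Lz =
      z/\<mu>. Since 1/\<mu> - L has the left inverse \<open>resolvent ?r\<close>, z
      vanishes.\<close>
    then have z: "z = (- ?r) *\<^sub>R resolvent 0 z" using assms by simp
    have "(- ?r) *\<^sub>R resolvent 0 z \<in> generator_domain T"
      "generator T ((- ?r) *\<^sub>R resolvent 0 z) = ?r *\<^sub>R z"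
      using generator_resolvent[of 0 z] generator_scaleR[of "resolvent 0 z" "- ?r"] by simp_all
    then have "z \<in> generator_domain T" "generator T z = ?r *\<^sub>R z"
      using z by simp_all
    from resolvent_generator[OF r this(1)] this(2) have "z = 0"
      using linear_0[OF bounded_linear.linear[OF bounded_linear_resolvent[OF r]]] by simp
    then show "x = y" by (simp add: z_def)
  qed
  \<comment> \<open>From Ly = (y - u)/\<mu> and B(Ly) = -y one gets By - Bu = -\<mu>y, which is the
    required equation.\<close>
  define y where "y = ?r *\<^sub>R resolvent ?r u"
  have y: "y \<in> generator_domain T" "generator T y = ?r *\<^sub>R (y - u)"
    using generator_resolvent[OF r, of u] generator_scaleR[of "resolvent ?r u" ?r]
    by (simp_all add: y_def scaleR_diff_right)
  have "resolvent 0 (?r *\<^sub>R (y - u)) = - y"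
    using resolvent_generator[OF order_refl y(1)] y(2) by simp
  then have "?r *\<^sub>R (resolvent 0 y - resolvent 0 u) = - y"
    by (simp add: linear_scale[OF lin0] linear_diff[OF lin0])
  then have "\<mu> *\<^sub>R (?r *\<^sub>R (resolvent 0 y - resolvent 0 u)) = \<mu> *\<^sub>R (- y)" by (rule arg_cong)
  then have "resolvent 0 y - resolvent 0 u = - (\<mu> *\<^sub>R y)" using assms by simp
  then have "\<mu> *\<^sub>R y + resolvent 0 y = resolvent 0 u"
    by (simp add: algebra_simps)
  then show "\<mu> *\<^sub>R (resolvent ?r u /\<^sub>R \<mu>) + resolvent 0 (resolvent ?r u /\<^sub>R \<mu>) = resolvent 0 u"
    by (simp add: y_def inverse_eq_divide)
qed

subsection \<open>Fractional powers\<close>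

lemma continuous_on_T_compose:
  assumes "S \<subseteq> {0..}"
  shows "continuous_on S (\<lambda>t. T t u)"
  using continuous_on_T assms by (rule continuous_on_subset)

text \<open>Dominated convergence along sequences: for r \<ge> 0 the factor e^(-rt) is at most 1, so
  the majorant of T(t)u serves all \<open>r\<close> at once.\<close>

lemma continuous_on_resolvent: "continuous_on {0..} (\<lambda>r. resolvent r u)"
  unfolding continuous_on_sequentially
proof (intro ballI allI impI)
  fix X :: "nat \<Rightarrow> real" and r
  assume r: "r \<in> {0..}" and X: "(\<forall>n. X n \<in> {0..}) \<and> X \<longlonglongrightarrow> r"
  have cont: "continuous_on {0..} (\<lambda>t. exp (- q * t) *\<^sub>R T t u)" for q
    by (intro continuous_intros continuous_on_T)
  have int: "(\<lambda>t. exp (- q * t) *\<^sub>R T t u) integrable_on {0..}" if "q \<ge> 0" for q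
    using stable_semigroup.integrable_T[OF stable_semigroup_rescaled[OF that]] by (simp add: rescaled_def)
  have le: "norm (exp (- q * t) *\<^sub>R T t u) \<le> M * exp (- \<epsilon> * t) * norm u" if "q \<ge> 0" "t \<ge> 0" for q t
  proof -
    have "exp (- q * t) * norm (T t u) \<le> 1 * norm (T t u)"
      using that by (intro mult_right_mono) auto
    then show ?thesis using norm_le[OF that(2), of u] by simp
  qed
  have "(\<lambda>n. integral {0..} (\<lambda>t. exp (- X n * t) *\<^sub>R T t u)) \<longlonglongrightarrow> integral {0..} (\<lambda>t. exp (- r * t) *\<^sub>R T t u)"
  proof (rule tendsto_integral_dominated[where h = "\<lambda>t. M * exp (- \<epsilon> * t) * norm u"])
    show "(\<lambda>t. M * exp (- \<epsilon> * t) * norm u) integrable_on {0..}"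
      using has_integral_dominating by blast
    fix t :: real assume "t \<in> {0..}"
    have "(\<lambda>n. exp (- X n * t) *\<^sub>R T t u) \<longlonglongrightarrow> exp (- r * t) *\<^sub>R T t u"
      using X by (intro tendsto_intros) auto
    then show "(\<lambda>n. indicator {0..} t *\<^sub>R (exp (- X n * t) *\<^sub>R T t u)) \<longlonglongrightarrow> exp (- r * t) *\<^sub>R T t u"
      using \<open>t \<in> {0..}\<close> by simp
  qed (use r X cont int le in auto)
  then show "((\<lambda>r. resolvent r u) \<circ> X) \<longlonglongrightarrow> resolvent r u"
    by (simp add: resolvent_def comp_def)
qed

lemma integrable_powr_dominating:
  assumes "s > 0"
  shows "(\<lambda>t. t powr (s - 1) * (M * exp (- \<epsilon> * t) * norm u)) integrable_on {0<..}"
proof -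
  have "(\<lambda>t. (M * norm u) * (t powr (s - 1) * exp (- \<epsilon> * t))) integrable_on {0<..}"
    using integrable_on_powr_times_exp[OF assms \<epsilon>_pos] by (rule integrable_on_mult_right)
  then show ?thesis by (simp add: mult_ac)
qed

lemma Bochner_integrable_powr_T:
  assumes "s > 0"
  shows "Bochner_integrable_on (\<lambda>t. t powr (s - 1) *\<^sub>R T t u) {0<..}"
proof (rule Bochner_integrable_on_continuous_dominated[OF _ integrable_powr_dominating[OF assms, of u]])
  show "continuous_on {0<..} (\<lambda>t. t powr (s - 1) *\<^sub>R T t u)"
    by (intro continuous_intros continuous_on_T_compose) auto
  show "norm (t powr (s - 1) *\<^sub>R T t u) \<le> t powr (s - 1) * (M * exp (- \<epsilon> * t) * norm u)" if "t > 0" for t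
    using norm_le[of t u] that by (simp add: mult_left_mono)
qed

text \<open>Integrating the majorant over the whole half-line gives a bound independent of
  \<open>a\<close> and \<open>b\<close>, so all truncations share one dominating function of
  \<open>r\<close>.\<close>

lemma norm_truncated_resolvent_le:
  assumes "r \<ge> 0" "a \<ge> 0"
  shows "norm (integral {a..b} (\<lambda>t. exp (- r * t) *\<^sub>R T t u)) \<le> M / (\<epsilon> + r) * norm u"
proof -
  interpret S: stable_semigroup "rescaled r" M "\<epsilon> + r"
    using assms(1) by (rule stable_semigroup_rescaled)
  let ?g = "\<lambda>t. M * exp (- (\<epsilon> + r) * t) * norm u"
  have sub: "{a..b} \<subseteq> {0..}" using assms by auto
  have g: "?g integrable_on {a..b}"
    by (intro integrable_continuous_interval continuous_intros)
  have "norm (integral {a..b} (\<lambda>t. rescaled r t u)) \<le> integral {a..b} ?g"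
  proof (rule integral_norm_bound_integral[OF _ g])
    show "(\<lambda>t. rescaled r t u) integrable_on {a..b}"
      by (intro integrable_continuous_interval S.continuous_on_T_compose sub)
  qed (use S.norm_le sub in auto)
  also have "\<dots> \<le> integral {0..} ?g"
    using S.has_integral_dominating[of u] M_pos by (intro integral_subset_le sub g) auto
  also have "\<dots> = M / (\<epsilon> + r) * norm u"
    by (rule integral_unique[OF S.has_integral_dominating])
  finally show ?thesis by (simp add: rescaled_def)
qed

lemma tendsto_truncated_resolvent:
  assumes "r \<ge> 0"
  shows "(\<lambda>n. integral {inverse (real (Suc n))..real (Suc n)} (\<lambda>t. exp (- r * t) *\<^sub>R T t u)) \<longlonglongrightarrow> resolvent r u"
proof -
  interpret S: stable_semigroup "rescaled r" M "\<epsilon> + r"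
    using assms by (rule stable_semigroup_rescaled)
  have sub: "{inverse (real (Suc n))..real (Suc n)} \<subseteq> {0<..}" for n
    by (auto intro: less_le_trans[rotated])
  have sub0: "{inverse (real (Suc n))..real (Suc n)} \<subseteq> {0..}" for n
    using sub[of n] by auto
  have "(\<lambda>n. integral {inverse (real (Suc n))..real (Suc n)} (\<lambda>t. rescaled r t u))
      \<longlonglongrightarrow> integral {0<..} (\<lambda>t. rescaled r t u)"
  proof (rule tendsto_integral_dominated[where h = "\<lambda>t. M * exp (- (\<epsilon> + r) * t) * norm u"])
    show "continuous_on {0<..} (\<lambda>t. rescaled r t u)" by (rule S.continuous_on_T_compose) auto
    show "(\<lambda>t. rescaled r t u) integrable_on {0<..}"
      using S.integrable_T by (simp add: integrable_on_Ici_iff_Ioi)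
    show "(\<lambda>t. M * exp (- (\<epsilon> + r) * t) * norm u) integrable_on {0<..}"
      using S.has_integral_dominating[of u] integrable_on_Ici_iff_Ioi(1) by blast
    show "continuous_on {inverse (real (Suc n))..real (Suc n)} (\<lambda>t. rescaled r t u)" for n
      by (rule S.continuous_on_T_compose[OF sub0])
    then show "(\<lambda>t. rescaled r t u) integrable_on {inverse (real (Suc n))..real (Suc n)}" for n
      by (rule integrable_continuous_interval)
    show "norm (rescaled r t u) \<le> M * exp (- (\<epsilon> + r) * t) * norm u" if "t \<in> {0<..}" for t
      using that by (intro S.norm_le) auto
    show "norm (rescaled r t u) \<le> M * exp (- (\<epsilon> + r) * t) * norm u"
      if "t \<in> {inverse (real (Suc n))..real (Suc n)}" for n t
      using subsetD[OF sub0 that] by (intro S.norm_le) auto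
    show "(\<lambda>n. indicator {inverse (real (Suc n))..real (Suc n)} t *\<^sub>R rescaled r t u) \<longlonglongrightarrow> rescaled r t u"
      if "t \<in> {0<..}" for t
      by (rule tendsto_eventually[OF eventually_mono[OF eventually_mem_Icc_inverse[of t]]])
        (use that in auto)
  qed (use sub in auto)
  then show ?thesis
    by (simp add: resolvent_def rescaled_def integrable_on_Ici_iff_Ioi)
qed

text \<open>Since a > 0, the kernel is continuous on the compact square, so the order of integration
  can be exchanged there.\<close>

lemma integral_truncated_swap:
  assumes "a > 0"
  shows "integral {a..b} (\<lambda>\<mu>. \<mu> powr (s - 2) *\<^sub>R integral {a..b} (\<lambda>t. exp (- (1 / \<mu>) * t) *\<^sub>R T t u)) =
    integral {a..b} (\<lambda>t. integral {a..b} (\<lambda>\<mu>. \<mu> powr (s - 2) * exp (- (t / \<mu>))) *\<^sub>R T t u)"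
proof -
  let ?f = "\<lambda>\<mu> t. (\<mu> powr (s - 2) * exp (- (t / \<mu>))) *\<^sub>R T t u"
  have cont: "continuous_on (cbox (a, a) (b, b)) (\<lambda>(\<mu>, t). ?f \<mu> t)"
    unfolding split_def cbox_Pair_eq
  proof (intro continuous_intros continuous_on_compose2[OF continuous_on_T continuous_on_snd])
    show "snd ` (cbox a b \<times> cbox a b) \<subseteq> {0..}" using assms by auto
  qed (use assms in auto)
  have "\<mu> powr (s - 2) *\<^sub>R integral {a..b} (\<lambda>t. exp (- (1 / \<mu>) * t) *\<^sub>R T t u)
      = integral {a..b} (?f \<mu>)" for \<mu>
    by (subst integral_cmul[symmetric]) simp
  then have "integral {a..b} (\<lambda>\<mu>. \<mu> powr (s - 2) *\<^sub>R integral {a..b} (\<lambda>t. exp (- (1 / \<mu>) * t) *\<^sub>R T t u))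
      = integral {a..b} (\<lambda>\<mu>. integral {a..b} (?f \<mu>))"
    by simp
  also have "\<dots> = integral {a..b} (\<lambda>t. integral {a..b} (\<lambda>\<mu>. ?f \<mu> t))"
    using integral_swap_continuous[OF cont] by simp
  also have "\<dots> = integral {a..b} (\<lambda>t. integral {a..b} (\<lambda>\<mu>. \<mu> powr (s - 2) * exp (- (t / \<mu>))) *\<^sub>R T t u)"
  proof (intro integral_cong)
    fix t assume "t \<in> {a..b}"
    have "(\<lambda>\<mu>. \<mu> powr (s - 2) * exp (- (t / \<mu>))) integrable_on {a..b}"
      using assms by (intro integrable_continuous_interval continuous_intros) auto
    from has_integral_scaleR_left[OF integrable_integral[OF this]]
    show "integral {a..b} (\<lambda>\<mu>. ?f \<mu> t) = integral {a..b} (\<lambda>\<mu>. \<mu> powr (s - 2) * exp (- (t / \<mu>))) *\<^sub>R T t u"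
      by (rule integral_unique)
  qed
  finally show ?thesis .
qed

lemma continuous_on_powr_resolvent:
  "continuous_on {0<..} (\<lambda>\<mu>. \<mu> powr (s - 2) *\<^sub>R resolvent (1 / \<mu>) u)"
  by (intro continuous_intros continuous_on_compose2[OF continuous_on_resolvent]) auto

lemma integrable_powr_resolvent_bound:
  assumes "0 < s" "s < 1"
  shows "(\<lambda>\<mu>. \<mu> powr (s - 2) * (M / (\<epsilon> + 1 / \<mu>) * norm u)) integrable_on {0<..}"
proof -
  have "(\<lambda>\<mu>. (M * norm u) * (\<mu> powr (s - 2) / (1 / \<mu> + \<epsilon>))) integrable_on {0<..}"
    using integrable_on_powr_divide[OF assms \<epsilon>_pos] by (rule integrable_on_mult_right)
  then show ?thesis by (simp add: mult_ac add.commute)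
qed

lemma norm_powr_resolvent_le:
  assumes "\<mu> > 0"
  shows "norm (\<mu> powr (s - 2) *\<^sub>R resolvent (1 / \<mu>) u) \<le> \<mu> powr (s - 2) * (M / (\<epsilon> + 1 / \<mu>) * norm u)"
  unfolding norm_scaleR using assms norm_resolvent_le[of "1 / \<mu>" u]
  by (simp add: mult_left_mono del: times_divide_eq_left times_divide_eq_right)

lemma Bochner_integrable_powr_resolvent:
  assumes "0 < s" "s < 1"
  shows "Bochner_integrable_on (\<lambda>\<mu>. \<mu> powr (s - 2) *\<^sub>R resolvent (1 / \<mu>) u) {0<..}"
  by (rule Bochner_integrable_on_continuous_dominated[OF continuous_on_powr_resolvent
        integrable_powr_resolvent_bound[OF assms] norm_powr_resolvent_le])

text \<open>Both variables are truncated to the same interval \<open>K n\<close>, where the two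
  orders of integration agree. The iterated integrals converge to the two sides, so uniqueness of
  limits gives the identity.\<close>

lemma integral_powr_resolvent:
  assumes s: "0 < s" "s < 1"
  shows "integral {0<..} (\<lambda>\<mu>. \<mu> powr (s - 2) *\<^sub>R resolvent (1 / \<mu>) u) =
    Gamma (1 - s) *\<^sub>R integral {0<..} (\<lambda>t. t powr (s - 1) *\<^sub>R T t u)"
proof -
  define K where "K = (\<lambda>n. {inverse (real (Suc n))..real (Suc n)})"
  have K_pos: "inverse (real (Suc n)) > 0" for n by simp
  have K_sub: "K n \<subseteq> {0<..}" for n by (auto simp: K_def intro: less_le_trans[rotated])
  have K_box: "K n = cbox (inverse (real (Suc n))) (real (Suc n))" for n by (simp add: K_def)
  have K_ev: "eventually (\<lambda>n. t \<in> K n) sequentially" if "t \<in> {0<..}" for t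
    using eventually_mem_Icc_inverse[of t] that by (simp add: K_def)
  define g where "g = (\<lambda>n \<mu>. \<mu> powr (s - 2) *\<^sub>R integral (K n) (\<lambda>t. exp (- (1 / \<mu>) * t) *\<^sub>R T t u))"
  define k where "k = (\<lambda>n t. integral (K n) (\<lambda>\<mu>. \<mu> powr (s - 2) * exp (- (t / \<mu>))))"
  have cont_g: "continuous_on (K n) (g n)" for n
    unfolding g_def K_box
  proof (intro continuous_intros integral_continuous_on_param)
    show "continuous_on (cbox (inverse (real (Suc n))) (real (Suc n)) \<times> cbox (inverse (real (Suc n))) (real (Suc n)))
        (\<lambda>(\<mu>, t). exp (- (1 / \<mu>) * t) *\<^sub>R T t u)"
      unfolding split_def
    proof (intro continuous_intros continuous_on_compose2[OF continuous_on_T continuous_on_snd])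
      show "snd ` (cbox (inverse (real (Suc n))) (real (Suc n)) \<times> cbox (inverse (real (Suc n))) (real (Suc n))) \<subseteq> {0..}"
        using K_sub[of n] by (auto simp: K_box)
    qed (use K_sub[of n] in \<open>auto simp: K_box\<close>)
  qed (use K_sub[of n] in \<open>auto simp: K_box\<close>)
  have cont_k: "continuous_on (K n) (k n)" for n
    unfolding k_def K_box
  proof (intro integral_continuous_on_param)
    show "continuous_on (cbox (inverse (real (Suc n))) (real (Suc n)) \<times> cbox (inverse (real (Suc n))) (real (Suc n)))
        (\<lambda>(t, \<mu>). \<mu> powr (s - 2) * exp (- (t / \<mu>)))"
      unfolding split_def
      by (intro continuous_intros) (use K_sub[of n] in \<open>auto simp: K_box\<close>)
  qed
  have cont_T: "continuous_on (K n) (\<lambda>t. T t u)" for n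
    using K_sub[of n] by (intro continuous_on_T_compose) auto
  have int_K: "f integrable_on K n" if "continuous_on (K n) f" for f :: "real \<Rightarrow> 'a" and n
    using that unfolding K_def by (rule integrable_continuous_interval)
  \<comment> \<open>Here the outer domain and the inner resolvent integral are truncated
    simultaneously; the resolvent bound dominates both.\<close>
  have 1: "(\<lambda>n. integral (K n) (g n)) \<longlonglongrightarrow> integral {0<..} (\<lambda>\<mu>. \<mu> powr (s - 2) *\<^sub>R resolvent (1 / \<mu>) u)"
  proof (rule tendsto_integral_dominated[OF continuous_on_powr_resolvent _ _ _ K_sub cont_g int_K[OF cont_g]
        integrable_powr_resolvent_bound[OF s]])
    show "(\<lambda>\<mu>. \<mu> powr (s - 2) *\<^sub>R resolvent (1 / \<mu>) u) integrable_on {0<..}"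
      by (rule Bochner_integral_on_eq_integral(1)[OF Bochner_integrable_powr_resolvent[OF s]])
    show "K n \<in> sets borel" for n by (simp add: K_def)
    fix \<mu> :: real assume \<mu>: "\<mu> \<in> {0<..}"
    show "norm (\<mu> powr (s - 2) *\<^sub>R resolvent (1 / \<mu>) u) \<le> \<mu> powr (s - 2) * (M / (\<epsilon> + 1 / \<mu>) * norm u)"
      using \<mu> by (intro norm_powr_resolvent_le) auto
    have "(\<lambda>n. integral (K n) (\<lambda>t. exp (- (1 / \<mu>) * t) *\<^sub>R T t u)) \<longlonglongrightarrow> resolvent (1 / \<mu>) u"
      unfolding K_def using \<mu> by (intro tendsto_truncated_resolvent) auto
    then have "(\<lambda>n. g n \<mu>) \<longlonglongrightarrow> \<mu> powr (s - 2) *\<^sub>R resolvent (1 / \<mu>) u"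
      unfolding g_def by (intro tendsto_intros)
    then show "(\<lambda>n. indicator (K n) \<mu> *\<^sub>R g n \<mu>) \<longlonglongrightarrow> \<mu> powr (s - 2) *\<^sub>R resolvent (1 / \<mu>) u"
      by (rule Lim_transform_eventually) (rule eventually_mono[OF K_ev[OF \<mu>]], simp)
  next
    fix n \<mu> assume "\<mu> \<in> K n"
    then have "\<mu> > 0" using K_sub by auto
    then have "norm (integral (K n) (\<lambda>t. exp (- (1 / \<mu>) * t) *\<^sub>R T t u)) \<le> M / (\<epsilon> + 1 / \<mu>) * norm u"
      unfolding K_def by (intro norm_truncated_resolvent_le) auto
    then show "norm (g n \<mu>) \<le> \<mu> powr (s - 2) * (M / (\<epsilon> + 1 / \<mu>) * norm u)"
      unfolding g_def norm_scaleR by (simp add: mult_left_mono del: times_divide_eq_left times_divide_eq_right)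
  qed simp
  \<comment> \<open>The truncated kernel \<open>k n t\<close> stays below its limit
    \<open>Gamma (1 - s) * t powr (s - 1)\<close>, which supplies the majorant.\<close>
  have 2: "(\<lambda>n. integral (K n) (\<lambda>t. k n t *\<^sub>R T t u)) \<longlonglongrightarrow>
      integral {0<..} (\<lambda>t. Gamma (1 - s) *\<^sub>R (t powr (s - 1) *\<^sub>R T t u))"
  proof (rule tendsto_integral_dominated[OF _ _ _ _ K_sub _ int_K
        integrable_on_mult_right[OF integrable_powr_dominating[OF s(1), of u], of "Gamma (1 - s)"]])
    show "continuous_on {0<..} (\<lambda>t. Gamma (1 - s) *\<^sub>R (t powr (s - 1) *\<^sub>R T t u))"
      by (intro continuous_intros continuous_on_T_compose) auto
    show "(\<lambda>t. Gamma (1 - s) *\<^sub>R (t powr (s - 1) *\<^sub>R T t u)) integrable_on {0<..}"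
      by (intro integrable_cmul Bochner_integral_on_eq_integral(1) Bochner_integrable_powr_T s)
    show "K n \<in> sets borel" for n by (simp add: K_def)
    show cont: "continuous_on (K n) (\<lambda>t. k n t *\<^sub>R T t u)" for n
      by (intro continuous_intros cont_k cont_T)
    then show "continuous_on (K n) (\<lambda>t. k n t *\<^sub>R T t u)" for n .
    have Gamma_pos: "Gamma (1 - s) > 0" using s by (intro Gamma_real_pos) auto
    fix t :: real assume t: "t \<in> {0<..}"
    show "norm (Gamma (1 - s) *\<^sub>R (t powr (s - 1) *\<^sub>R T t u))
        \<le> Gamma (1 - s) * (t powr (s - 1) * (M * exp (- \<epsilon> * t) * norm u))"
      using norm_le[of t u] t Gamma_pos by (simp add: mult_left_mono)
    have "(\<lambda>n. k n t) \<longlonglongrightarrow> Gamma (1 - s) * t powr (s - 1)"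
      using tendsto_integral_powr_times_exp_inverse[of t s] t s by (simp add: k_def K_def)
    then have "(\<lambda>n. k n t *\<^sub>R T t u) \<longlonglongrightarrow> (Gamma (1 - s) * t powr (s - 1)) *\<^sub>R T t u"
      by (intro tendsto_intros)
    then have "(\<lambda>n. k n t *\<^sub>R T t u) \<longlonglongrightarrow> Gamma (1 - s) *\<^sub>R (t powr (s - 1) *\<^sub>R T t u)"
      by simp
    then show "(\<lambda>n. indicator (K n) t *\<^sub>R (k n t *\<^sub>R T t u)) \<longlonglongrightarrow> Gamma (1 - s) *\<^sub>R (t powr (s - 1) *\<^sub>R T t u)"
      by (rule Lim_transform_eventually) (rule eventually_mono[OF K_ev[OF t]], simp)
  next
    fix n t assume "t \<in> K n"
    then have t: "t > 0" using K_sub by auto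
    have "k n t \<le> Gamma (1 - s) * t powr (s - 1)"
      using integral_powr_times_exp_inverse_le[OF t s(2), of n] by (simp add: k_def K_def)
    moreover have "k n t \<ge> 0"
      unfolding k_def
    proof (rule integral_nonneg)
      show "(\<lambda>\<mu>. \<mu> powr (s - 2) * exp (- (t / \<mu>))) integrable_on K n"
        unfolding K_def using K_pos[of n]
        by (intro integrable_continuous_interval continuous_intros) auto
    qed simp
    ultimately have "k n t * norm (T t u) \<le> (Gamma (1 - s) * t powr (s - 1)) * (M * exp (- \<epsilon> * t) * norm u)"
      using norm_le[of t u] t by (intro mult_mono) auto
    then show "norm (k n t *\<^sub>R T t u) \<le> Gamma (1 - s) * (t powr (s - 1) * (M * exp (- \<epsilon> * t) * norm u))"
      using \<open>k n t \<ge> 0\<close> by (simp add: mult.assoc)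
  qed simp
  have "integral (K n) (g n) = integral (K n) (\<lambda>t. k n t *\<^sub>R T t u)" for n
    unfolding g_def k_def K_def by (rule integral_truncated_swap[OF K_pos])
  then have "integral {0<..} (\<lambda>\<mu>. \<mu> powr (s - 2) *\<^sub>R resolvent (1 / \<mu>) u) =
      integral {0<..} (\<lambda>t. Gamma (1 - s) *\<^sub>R (t powr (s - 1) *\<^sub>R T t u))"
    using LIMSEQ_unique[OF 1] 2 by simp
  then show ?thesis by (simp only: integral_cmul)
qed

text \<open>The factor 1/\<mu> from \<open>resolvent_identity\<close> lowers the exponent from s - 1
  to s - 2, and the reflection formula collapses the constants to 1 / Gamma(s).\<close>

lemma frac_power_resolvent_0:
  assumes s: "0 < s" "s < 1"
  shows "frac_power (resolvent 0) s u = (1 / Gamma s) *\<^sub>R integral {0<..} (\<lambda>t. t powr (s - 1) *\<^sub>R T t u)"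
proof -
  have "\<mu> powr (s - 1) *\<^sub>R inv (\<lambda>x. \<mu> *\<^sub>R x + resolvent 0 x) (resolvent 0 u)
      = \<mu> powr (s - 2) *\<^sub>R resolvent (1 / \<mu>) u" if "\<mu> \<in> {0<..}" for \<mu>
  proof -
    have "\<mu> powr (s - 1) = \<mu> powr (s - 2) * \<mu> powr 1"
      by (subst powr_add[symmetric]) simp
    then show ?thesis using that by (simp add: resolvent_identity)
  qed
  then have "frac_power (resolvent 0) s u = (sin (s * pi) / pi) *\<^sub>R
      Bochner_integral_on {0<..} (\<lambda>\<mu>. \<mu> powr (s - 2) *\<^sub>R resolvent (1 / \<mu>) u)"
    using s unfolding frac_power_def by (subst Bochner_integral_on_cong) auto
  also have "\<dots> = (sin (s * pi) / pi) *\<^sub>R (Gamma (1 - s) *\<^sub>R integral {0<..} (\<lambda>t. t powr (s - 1) *\<^sub>R T t u))"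
    by (simp only: Bochner_integral_on_eq_integral(2)[OF Bochner_integrable_powr_resolvent[OF s]]
        integral_powr_resolvent[OF s])
  also have "\<dots> = (sin (s * pi) / pi * Gamma (1 - s)) *\<^sub>R integral {0<..} (\<lambda>t. t powr (s - 1) *\<^sub>R T t u)"
    by simp
  finally show ?thesis unfolding Gamma_reflection_real[OF s] .
qed

subsection \<open>The logarithm\<close>

text \<open>The two terms are bounded separately by power times exponential; for s > 0 the
  singularity at 0 is integrable without any cancellation.\<close>

lemma Bochner_integrable_log_integrand:
  assumes s: "s > 0"
  shows "Bochner_integrable_on (\<lambda>t. (T t u - exp (- t) *\<^sub>R u) /\<^sub>R (t powr (1 - s))) {0<..}"
proof (rule Bochner_integrable_on_continuous_dominated)
  show "continuous_on {0<..} (\<lambda>t. (T t u - exp (- t) *\<^sub>R u) /\<^sub>R (t powr (1 - s)))"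
    by (intro continuous_intros continuous_on_T_compose) auto
  show "(\<lambda>t. t powr (s - 1) * (M * exp (- \<epsilon> * t) * norm u) + t powr (s - 1) * exp (- 1 * t) * norm u) integrable_on {0<..}"
    using integrable_on_powr_times_exp[OF s, of 1]
    by (intro integrable_add integrable_powr_dominating s integrable_on_mult_left) auto
  fix t :: real assume t: "t > 0"
  have "norm (T t u - exp (- t) *\<^sub>R u) \<le> M * exp (- \<epsilon> * t) * norm u + exp (- 1 * t) * norm u"
    using norm_triangle_ineq4[of "T t u" "exp (- t) *\<^sub>R u"] norm_le[of t u] t by simp
  then have "t powr (s - 1) * norm (T t u - exp (- t) *\<^sub>R u)
      \<le> t powr (s - 1) * (M * exp (- \<epsilon> * t) * norm u + exp (- 1 * t) * norm u)"
    by (intro mult_left_mono) auto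
  moreover have "t powr (s - 1) = inverse (t powr (1 - s))"
    using powr_minus[of t "1 - s"] by simp
  ultimately show "norm ((T t u - exp (- t) *\<^sub>R u) /\<^sub>R (t powr (1 - s)))
      \<le> t powr (s - 1) * (M * exp (- \<epsilon> * t) * norm u) + t powr (s - 1) * exp (- 1 * t) * norm u"
    by (simp add: distrib_left mult.assoc)
qed

lemma frac_power_difference_quotient:
  assumes s: "0 < s" "s < 1"
  shows "(frac_power (resolvent 0) s u - u) /\<^sub>R s = (1 / Gamma (1 + s)) *\<^sub>R
    Bochner_integral_on {0<..} (\<lambda>t. (T t u - exp (- t) *\<^sub>R u) /\<^sub>R (t powr (1 - s)))"
proof -
  have Gamma_nz: "Gamma s \<noteq> 0" using Gamma_real_pos[OF s(1)] by (rule less_imp_neq[symmetric])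
  have "s \<notin> \<int>\<^sub>\<le>\<^sub>0"
    using s by (auto elim!: nonpos_Ints_cases)
  then have Gamma_plus1: "Gamma (1 + s) = s * Gamma s"
    using Gamma_plus1[of s] by (simp add: add.commute)
  have "((\<lambda>t. (t powr (s - 1) * exp (- t)) *\<^sub>R u) has_integral Gamma s *\<^sub>R u) {0<..}"
    by (intro has_integral_scaleR_left has_integral_Gamma s)
  moreover have "((\<lambda>t. t powr (s - 1) *\<^sub>R T t u) has_integral
      integral {0<..} (\<lambda>t. t powr (s - 1) *\<^sub>R T t u)) {0<..}"
    using Bochner_integral_on_eq_integral(1)[OF Bochner_integrable_powr_T[OF s(1), of u]]
    by (rule integrable_integral)
  ultimately have "((\<lambda>t. t powr (s - 1) *\<^sub>R T t u - (t powr (s - 1) * exp (- t)) *\<^sub>R u) has_integral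
      integral {0<..} (\<lambda>t. t powr (s - 1) *\<^sub>R T t u) - Gamma s *\<^sub>R u) {0<..}"
    by (intro has_integral_diff)
  moreover have "t powr (s - 1) *\<^sub>R T t u - (t powr (s - 1) * exp (- t)) *\<^sub>R u
      = (T t u - exp (- t) *\<^sub>R u) /\<^sub>R (t powr (1 - s))" for t
    using powr_minus[of t "1 - s"] by (simp add: scaleR_diff_right)
  ultimately have "integral {0<..} (\<lambda>t. (T t u - exp (- t) *\<^sub>R u) /\<^sub>R (t powr (1 - s)))
      = integral {0<..} (\<lambda>t. t powr (s - 1) *\<^sub>R T t u) - Gamma s *\<^sub>R u"
    by (simp add: integral_unique)
  moreover have "(frac_power (resolvent 0) s u - u) /\<^sub>R s =
      (1 / (s * Gamma s)) *\<^sub>R (integral {0<..} (\<lambda>t. t powr (s - 1) *\<^sub>R T t u) - Gamma s *\<^sub>R u)"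
    using s(1) by (simp add: frac_power_resolvent_0[OF s] scaleR_diff_right divide_inverse mult.commute
        right_inverse[OF Gamma_nz])
  ultimately show ?thesis
    by (simp only: Gamma_plus1 Bochner_integral_on_eq_integral(2)[OF Bochner_integrable_log_integrand[OF s(1)]])
qed

text \<open>Near 0 the integrand is the difference of the difference quotients of T(t)u and e^(-t)u,
  both convergent for u in D(L), hence bounded. Away from 0 both terms decay exponentially.\<close>

lemma log_integrand_bound:
  assumes "u \<in> generator_domain T"
  obtains c C where "c > 0" "C \<ge> 0"
    "\<And>t. t > 0 \<Longrightarrow> norm ((T t u - exp (- t) *\<^sub>R u) /\<^sub>R t) \<le> C * exp (- c * t)"
proof -
  \<comment> \<open>A common decay rate for T(t), with rate \<epsilon>, and e^(-t), with rate
    1.\<close>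
  define c where "c = min \<epsilon> 1"
  have c: "c > 0" "c \<le> \<epsilon>" "c \<le> 1" using \<epsilon>_pos by (auto simp: c_def)
  let ?f = "\<lambda>t. (T t u - exp (- t) *\<^sub>R u) /\<^sub>R t"
  have "((\<lambda>t. (exp (- 1 * t) *\<^sub>R u - u) /\<^sub>R t) \<longlongrightarrow> 0 - 1 *\<^sub>R u) (at_right 0)"
    by (rule tendsto_rescaled_difference_quotient[where T = "\<lambda>_ u. u"]) simp
  from tendsto_diff[OF tendsto_generator[OF assms] this]
  have "(?f \<longlongrightarrow> generator T u - (0 - 1 *\<^sub>R u)) (at_right 0)"
    by (simp add: scaleR_diff_right)
  then have "((\<lambda>t. norm (?f t)) \<longlongrightarrow> norm (generator T u - (0 - 1 *\<^sub>R u))) (at_right 0)"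
    by (rule tendsto_norm)
  then have "eventually (\<lambda>t. norm (?f t) < norm (generator T u - (0 - 1 *\<^sub>R u)) + 1) (at_right 0)"
    by (rule order_tendstoD) simp
  then obtain d where d: "d > 0" "\<And>t. 0 < t \<Longrightarrow> t < d \<Longrightarrow> norm (?f t) < norm (generator T u - (0 - 1 *\<^sub>R u)) + 1"
    by (auto simp: eventually_at_right_field)
  define B where "B = norm (generator T u - (0 - 1 *\<^sub>R u)) + 1"
  \<comment> \<open>One constant for both ranges: for t < d, e^(cd) e^(-ct) \<ge> 1 makes up for the
    decay; for t \<ge> d, 1/t is at most 1/d.\<close>
  define C where "C = B * exp (c * d) + (M + 1) * norm u / d"
  have B: "B \<ge> 0" by (simp add: B_def)
  have C: "C \<ge> 0" "B * exp (c * d) \<le> C" "(M + 1) * norm u / d \<le> C"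
    using B d(1) M_pos by (simp_all add: C_def)
  have "norm (?f t) \<le> C * exp (- c * t)" if t: "t > 0" for t
  proof (cases "t < d")
    case True
    have "norm (?f t) \<le> B * 1" using d(2)[OF t True] by (simp add: B_def)
    also have "B * 1 \<le> B * exp (c * d - c * t)"
      using B c(1) True by (intro mult_left_mono) auto
    also have "\<dots> = (B * exp (c * d)) * exp (- c * t)" by (simp add: mult_exp_exp)
    also have "\<dots> \<le> C * exp (- c * t)" using C by (intro mult_right_mono) auto
    finally show ?thesis .
  next
    case False
    have e: "exp (- \<epsilon> * t) \<le> exp (- c * t)" "exp (- t) \<le> exp (- c * t)"
      using c t mult_right_mono[of c \<epsilon> t] mult_right_mono[of c 1 t] by auto
    have "norm (T t u - exp (- t) *\<^sub>R u) \<le> M * exp (- \<epsilon> * t) * norm u + exp (- t) * norm u"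
      using norm_triangle_ineq4[of "T t u" "exp (- t) *\<^sub>R u"] norm_le[of t u] t by simp
    also have "\<dots> \<le> M * exp (- c * t) * norm u + exp (- c * t) * norm u"
      using e M_pos by (intro add_mono mult_right_mono mult_left_mono) auto
    also have "\<dots> = (M + 1) * norm u * exp (- c * t)" by (simp add: algebra_simps)
    finally have "norm (T t u - exp (- t) *\<^sub>R u) / t \<le> (M + 1) * norm u * exp (- c * t) / t"
      using t by (intro divide_right_mono) auto
    also have "\<dots> \<le> (M + 1) * norm u * exp (- c * t) / d"
      using False d(1) M_pos t by (intro divide_left_mono) auto
    also have "\<dots> = ((M + 1) * norm u / d) * exp (- c * t)" by simp
    also have "\<dots> \<le> C * exp (- c * t)" using C by (intro mult_right_mono) auto
    finally show ?thesis using t by (simp add: divide_inverse mult.commute)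
  qed
  with c(1) C(1) that show ?thesis by blast
qed

text \<open>The integrand with parameter \<open>s\<close> is t^s times the one at s = 0, and t^s
  \<le> 1 + t for 0 < s \<le> 1. So (1 + t) C e^(-ct) dominates uniformly in
  \<open>s\<close>.\<close>

lemma tendsto_log_integral:
  assumes u: "u \<in> generator_domain T"
  shows "Bochner_integrable_on (\<lambda>t. (T t u - exp (- t) *\<^sub>R u) /\<^sub>R t) {0<..}"
    and "((\<lambda>s. (1 / Gamma (1 + s)) *\<^sub>R
        Bochner_integral_on {0<..} (\<lambda>t. (T t u - exp (- t) *\<^sub>R u) /\<^sub>R (t powr (1 - s))))
      \<longlongrightarrow> integral {0<..} (\<lambda>t. (T t u - exp (- t) *\<^sub>R u) /\<^sub>R t)) (at_right 0)"
proof -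
  let ?f = "\<lambda>t. (T t u - exp (- t) *\<^sub>R u) /\<^sub>R t"
  let ?g = "\<lambda>s t. (T t u - exp (- t) *\<^sub>R u) /\<^sub>R (t powr (1 - s))"
  obtain c C where c: "c > 0" and C: "C \<ge> 0"
    and le: "\<And>t. t > 0 \<Longrightarrow> norm (?f t) \<le> C * exp (- c * t)"
    using log_integrand_bound[OF u] by blast
  have cont: "continuous_on {0<..} ?f"
    by (intro continuous_intros continuous_on_T_compose) auto
  \<comment> \<open>For t > 0 this is (1 + t) C e^(-ct), written as two Gamma integrands with
    parameters 1 and 2 so that integrability is immediate.\<close>
  define h where "h = (\<lambda>t. C * (t powr (1 - 1) * exp (- c * t)) + C * (t powr (2 - 1) * exp (- c * t)))"
  have h_int: "h integrable_on {0<..}"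
    unfolding h_def by (intro integrable_add integrable_on_mult_right integrable_on_powr_times_exp c) auto
  have h_eq: "h t = (1 + t) * (C * exp (- c * t))" if "t > 0" for t
    using that by (simp add: h_def algebra_simps)
  have f_le: "norm (?f t) \<le> h t" if "t > 0" for t
  proof -
    have "1 * (C * exp (- c * t)) \<le> (1 + t) * (C * exp (- c * t))"
      using that C by (intro mult_right_mono) auto
    then show ?thesis using le[OF that] h_eq[OF that] by simp
  qed
  show int: "Bochner_integrable_on ?f {0<..}"
    by (rule Bochner_integrable_on_continuous_dominated[OF cont h_int f_le])
  have g_eq: "?g s t = t powr s *\<^sub>R ?f t" if "t > 0" for s t
    using that by (simp add: powr_diff divide_inverse mult.commute)
  have g_le: "norm (?g s t) \<le> h t" if t: "t > 0" and s: "0 < s" "s \<le> 1" for s t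
  proof -
    have "t powr s \<le> 1 + t"
    proof (cases "t \<le> 1")
      case True
      then have "t powr s \<le> 1 powr s" using s t by (intro powr_mono2) auto
      then show ?thesis using t by simp
    next
      case False
      then have "t powr s \<le> t powr 1" using s by (intro powr_mono) auto
      then show ?thesis using t by simp
    qed
    then have "t powr s * norm (?f t) \<le> (1 + t) * (C * exp (- c * t))"
      using le[OF t] t by (intro mult_mono) auto
    then show ?thesis by (simp only: g_eq[OF t] norm_scaleR abs_of_nonneg[OF powr_ge_zero] h_eq[OF t])
  qed
  \<comment> \<open>Working within [0,1] keeps s \<le> 1, as the majorant requires, and sequences
    suffice; near 0 this is the right-hand limit.\<close>
  have "((\<lambda>s. integral {0<..} (?g s)) \<longlongrightarrow> integral {0<..} ?f) (at 0 within {0..1})"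
    unfolding tendsto_at_iff_sequentially
  proof (intro allI impI)
    fix X :: "nat \<Rightarrow> real"
    assume X: "\<forall>i. X i \<in> {0..1} - {0}" and lim: "X \<longlonglongrightarrow> 0"
    then have X: "0 < X n" "X n \<le> 1" for n
      by (auto simp: order_less_le)
    have "(\<lambda>n. integral {0<..} (?g (X n))) \<longlonglongrightarrow> integral {0<..} ?f"
    proof (rule tendsto_integral_dominated[OF cont _ _ _ _ _ _ h_int])
      show "?f integrable_on {0<..}" by (rule Bochner_integral_on_eq_integral(1)[OF int])
      show "continuous_on {0<..} (?g (X n))" for n
        by (intro continuous_intros continuous_on_T_compose) auto
      show "?g (X n) integrable_on {0<..}" for n
        by (rule Bochner_integral_on_eq_integral(1)[OF Bochner_integrable_log_integrand[OF X(1)]])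
      show "norm (?f t) \<le> h t" if "t \<in> {0<..}" for t using that by (intro f_le) auto
      show "norm (?g (X n) t) \<le> h t" if "t \<in> {0<..}" for n t using that X by (intro g_le) auto
      fix t :: real assume t: "t \<in> {0<..}"
      have "(\<lambda>n. t powr X n *\<^sub>R ?f t) \<longlonglongrightarrow> t powr 0 *\<^sub>R ?f t"
        using t by (intro tendsto_intros lim) auto
      moreover have "t powr 0 *\<^sub>R ?f t = ?f t" using t by simp
      moreover have "indicator {0<..} t *\<^sub>R ?g (X n) t = t powr X n *\<^sub>R ?f t" for n
        using t by (simp only: g_eq indicator_simps(1)[OF t] scaleR_one greaterThan_iff)
      ultimately show "(\<lambda>n. indicator {0<..} t *\<^sub>R ?g (X n) t) \<longlonglongrightarrow> ?f t"
        by (simp only:)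
    qed auto
    then show "((\<lambda>s. integral {0<..} (?g s)) \<circ> X) \<longlonglongrightarrow> integral {0<..} ?f"
      by (simp add: comp_def)
  qed
  then have lim: "((\<lambda>s. integral {0<..} (?g s)) \<longlongrightarrow> integral {0<..} ?f) (at_right 0)"
    by (simp add: at_within_Icc_at_right)
  have "((\<lambda>s::real. 1 / Gamma (1 + s)) \<longlongrightarrow> 1 / Gamma (1 + 0)) (at_right 0)"
    by (intro tendsto_intros) auto
  then have "((\<lambda>s::real. 1 / Gamma (1 + s)) \<longlongrightarrow> 1) (at_right 0)" by simp
  from tendsto_scaleR[OF this lim]
  have "((\<lambda>s. (1 / Gamma (1 + s)) *\<^sub>R integral {0<..} (?g s)) \<longlongrightarrow> integral {0<..} ?f) (at_right 0)"
    by simp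
  then show "((\<lambda>s. (1 / Gamma (1 + s)) *\<^sub>R Bochner_integral_on {0<..} (?g s)) \<longlongrightarrow> integral {0<..} ?f) (at_right 0)"
  proof (rule Lim_transform_eventually)
    show "\<forall>\<^sub>F s in at_right 0. (1 / Gamma (1 + s)) *\<^sub>R integral {0<..} (?g s)
        = (1 / Gamma (1 + s)) *\<^sub>R Bochner_integral_on {0<..} (?g s)"
      using eventually_at_right_less[of "0::real"]
      by (rule eventually_mono) (simp only: Bochner_integral_on_eq_integral(2)[OF Bochner_integrable_log_integrand])
  qed
qed

section \<open>Transfer to the given operator\<close>

text \<open>Equality holds as functions on the whole space because -L maps D(L) onto it: every u is
  the image of \<open>resolvent 0 u\<close>. Only the values of \<open>L\<close> on the domain
  enter.\<close>

lemma the_inv_into_generator: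
  assumes "\<And>x. x \<in> generator_domain T \<Longrightarrow> L x = generator T x"
  shows "the_inv_into (generator_domain T) (\<lambda>x. - L x) = resolvent 0"
proof
  fix u
  show "the_inv_into (generator_domain T) (\<lambda>x. - L x) u = resolvent 0 u"
  proof (rule the_inv_into_f_eq)
    show "inj_on (\<lambda>x. - L x) (generator_domain T)"
      using inj_on_generator assms by (simp add: inj_on_def)
  qed (use generator_resolvent[of 0 u] assms in auto)
qed

end

theorem proposition3p3:
  fixes T :: "real \<Rightarrow> 'a::banach \<Rightarrow> 'a"
    and D :: "'a set" and L :: "'a \<Rightarrow> 'a"
  assumes "C0_semigroup T" and "exponentially_stable T"
    and "D = generator_domain T" and "\<And>u. u \<in> D \<Longrightarrow> L u = generator T u"
  shows "\<forall>u.
    (\<forall>s>0. Bochner_integrable_on (\<lambda>t. (T t u - exp (- t) *\<^sub>R u) /\<^sub>R (t powr (1 - s))) {0<..}) \<and>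
    (u \<in> op_log_domain D (\<lambda>x. - L x) \<longleftrightarrow>
       (\<exists>v. ((\<lambda>s. (1 / Gamma (1 + s)) *\<^sub>R
              Bochner_integral_on {0<..} (\<lambda>t. (T t u - exp (- t) *\<^sub>R u) /\<^sub>R (t powr (1 - s))))
            \<longlongrightarrow> v) (at_right 0))) \<and>
    (u \<in> op_log_domain D (\<lambda>x. - L x) \<longrightarrow>
       ((\<lambda>s. (1 / Gamma (1 + s)) *\<^sub>R
           Bochner_integral_on {0<..} (\<lambda>t. (T t u - exp (- t) *\<^sub>R u) /\<^sub>R (t powr (1 - s))))
         \<longlongrightarrow> - op_log D (\<lambda>x. - L x) u) (at_right 0)) \<and>
    (u \<in> D \<longrightarrow>
       u \<in> op_log_domain D (\<lambda>x. - L x) \<and>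
       has_Bochner_integral_on (\<lambda>t. (T t u - exp (- t) *\<^sub>R u) /\<^sub>R t)
         (- op_log D (\<lambda>x. - L x) u) {0<..})"
proof
  fix u :: 'a
  obtain M \<epsilon> where M: "M > 0" "\<epsilon> > 0" "\<And>t u. t \<ge> 0 \<Longrightarrow> norm (T t u) \<le> M * exp (- \<epsilon> * t) * norm u"
    using assms(2) unfolding exponentially_stable_def by blast
  interpret stable_semigroup T M \<epsilon>
    by (rule stable_semigroup.intro[OF assms(1) M])
  define P where "P = neg_frac_power D (\<lambda>x. - L x)"
  define J where "J = (\<lambda>s. (1 / Gamma (1 + s)) *\<^sub>R
    Bochner_integral_on {0<..} (\<lambda>t. (T t u - exp (- t) *\<^sub>R u) /\<^sub>R (t powr (1 - s))))"
  have P: "P = frac_power (resolvent 0)"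
    unfolding P_def neg_frac_power_def using the_inv_into_generator[of L] assms(3,4) by simp
  \<comment> \<open>The two families agree on the whole interval (0,1), so existence and value of
    either limit carry over to the other.\<close>
  have ev: "\<forall>\<^sub>F s in at_right 0. (P s u - u) /\<^sub>R s = J s"
    unfolding eventually_at_right_field P J_def
    by (rule exI[of _ 1]) (auto intro: frac_power_difference_quotient)
  have iff: "((\<lambda>s. (P s u - u) /\<^sub>R s) \<longlongrightarrow> v) (at_right 0) \<longleftrightarrow> (J \<longlongrightarrow> v) (at_right 0)" for v
    by (rule tendsto_cong[OF ev])
  have dom: "u \<in> op_log_domain D (\<lambda>x. - L x) \<longleftrightarrow> (\<exists>v. (J \<longlongrightarrow> v) (at_right 0))"
    unfolding op_log_domain_def P_def[symmetric] generator_domain_def by (simp add: iff)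
  have lim: "(J \<longlongrightarrow> - op_log D (\<lambda>x. - L x) u) (at_right 0)" if "u \<in> op_log_domain D (\<lambda>x. - L x)"
    using tendsto_generator[of u P] that unfolding op_log_domain_def op_log_def P_def[symmetric] iff by simp
  have "u \<in> op_log_domain D (\<lambda>x. - L x) \<and>
       has_Bochner_integral_on (\<lambda>t. (T t u - exp (- t) *\<^sub>R u) /\<^sub>R t)
         (- op_log D (\<lambda>x. - L x) u) {0<..}" if "u \<in> D"
  proof -
    have u: "u \<in> generator_domain T" using that assms(3) by simp
    have J: "(J \<longlongrightarrow> integral {0<..} (\<lambda>t. (T t u - exp (- t) *\<^sub>R u) /\<^sub>R t)) (at_right 0)"
      unfolding J_def by (rule tendsto_log_integral(2)[OF u])
    then have u_dom: "u \<in> op_log_domain D (\<lambda>x. - L x)" using dom by blast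
    \<comment> \<open>The logarithm and the integral are both limits of \<open>J\<close> at 0 from
      the right.\<close>
    have "- op_log D (\<lambda>x. - L x) u = integral {0<..} (\<lambda>t. (T t u - exp (- t) *\<^sub>R u) /\<^sub>R t)"
      by (rule tendsto_unique[OF _ lim[OF u_dom] J]) simp
    then show ?thesis
      using u_dom Bochner_integral_on_eq_integral(3)[OF tendsto_log_integral(1)[OF u]] by simp
  qed
  then show "(\<forall>s>0. Bochner_integrable_on (\<lambda>t. (T t u - exp (- t) *\<^sub>R u) /\<^sub>R (t powr (1 - s))) {0<..}) \<and>
    (u \<in> op_log_domain D (\<lambda>x. - L x) \<longleftrightarrow>
       (\<exists>v. ((\<lambda>s. (1 / Gamma (1 + s)) *\<^sub>R
              Bochner_integral_on {0<..} (\<lambda>t. (T t u - exp (- t) *\<^sub>R u) /\<^sub>R (t powr (1 - s))))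
            \<longlongrightarrow> v) (at_right 0))) \<and>
    (u \<in> op_log_domain D (\<lambda>x. - L x) \<longrightarrow>
       ((\<lambda>s. (1 / Gamma (1 + s)) *\<^sub>R
           Bochner_integral_on {0<..} (\<lambda>t. (T t u - exp (- t) *\<^sub>R u) /\<^sub>R (t powr (1 - s))))
         \<longlongrightarrow> - op_log D (\<lambda>x. - L x) u) (at_right 0)) \<and>
    (u \<in> D \<longrightarrow>
       u \<in> op_log_domain D (\<lambda>x. - L x) \<and>
       has_Bochner_integral_on (\<lambda>t. (T t u - exp (- t) *\<^sub>R u) /\<^sub>R t)
         (- op_log D (\<lambda>x. - L x) u) {0<..})"
    using Bochner_integrable_log_integrand[of _ u] dom lim unfolding J_def by blast
qed

end
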